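(* Let $\mathbb{F}$ be a field and $n$ an integer with $|\mathbb{F}|>2n-2\geq 2$. Let $(V,s)$ be a symplectic space over $\mathbb{F}$ with dimension $2n>0$. Let $S$ be a nilpotent subspace of $\mathcal{A}_s$. Then $\dim S\leq n(n-1)$. If equality occurs, then $S$ is represented, in some symplectic basis of $(V,s)$, by the matrix space $$\mathrm{NT}_n(\mathbb{F})\,\triangle\,\{0\}=\left\{\begin{bmatrix}U&B\\0&U^T\end{bmatrix}\;\middle|\;U\in\mathrm{NT}_n(\mathbb{F}),\ B\in\mathrm{A}_n(\mathbb{F})\right\}.$$
   Context: A symplectic space $(V,s)$ is a finite-dimensional vector space with a non-degenerate alternating bilinear form $s$. $\mathcal{A}_s:=\{u\in\mathrm{End}(V):s(x,u(x))=0\ \forall x\in V\}$. A nilpotent subspace of $\mathcal{A}_s$ is a linear subspace of $\mathcal{A}_s$ in which all elements are nilpotent endomorphisms. $\mathrm{NT}_n(\mathbb{F})$ is the space of strictly upper-triangular $n\times n$ matrices and $\mathrm{A}_n(\mathbb{F})$ the space of alternating $n\times n$ matrices (skew-symmetric with zero diagonal). A symplectic basis of $(V,s)$ is a basis in which the Gram matrix of $s$ is $\begin{bmatrix}0&I_n\\-I_n&0\end{bmatrix}$. The characteristic of $\mathbb{F}$ is arbitrary. *)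

theory Defs
  imports
    "HOL-Library.Function_Algebras"
    "Jordan_Normal_Form.Matrix"
begin

text \<open>
  A vector space over \<open>'f\<close> is a type \<open>'v\<close> with a scalar multiplication \<open>scale\<close> such that
  \<open>vector_space scale\<close>.
\<close>

locale symplectic_space = vector_space scale
  for scale :: "'f::field \<Rightarrow> 'v::ab_group_add \<Rightarrow> 'v" +
  fixes s :: "'v \<Rightarrow> 'v \<Rightarrow> 'f"
  assumes finite_dim: "\<exists>Basis. finite_dimensional_vector_space scale Basis"
    and linear_left: "Vector_Spaces.linear scale (*) (\<lambda>x. s x y)"
    and linear_right: "Vector_Spaces.linear scale (*) (\<lambda>y. s x y)"
    and alternating: "s x x = 0"
    and nondegenerate: "(\<And>y. s x y = 0) \<Longrightarrow> x = 0"

definition fun_scale :: "('f \<Rightarrow> 'v \<Rightarrow> 'v) \<Rightarrow> 'f \<Rightarrow> ('v \<Rightarrow> 'v) \<Rightarrow> 'v \<Rightarrow> 'v" where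
  "fun_scale scale c u = (\<lambda>x. scale c (u x))"

text \<open>
  Addition of functions is pointwise (\<open>Function_Algebras\<close>), so subspaces of \<open>End(V)\<close> and their
  dimensions are taken in the space of all functions \<open>V \<rightarrow> V\<close>, of which \<open>End(V)\<close> is a subspace.
\<close>

lemma vector_space_fun_scale:
  assumes "vector_space scale"
  shows "vector_space (fun_scale scale)"
proof -
  interpret vector_space scale by (rule assms)
  show ?thesis
    by unfold_locales
      (simp_all add: fun_scale_def fun_eq_iff scale_right_distrib scale_left_distrib)
qed

definition alternating_endos :: "('f::field \<Rightarrow> 'v::ab_group_add \<Rightarrow> 'v) \<Rightarrow> ('v \<Rightarrow> 'v \<Rightarrow> 'f) \<Rightarrow> ('v \<Rightarrow> 'v) set" where
  "alternating_endos scale s = {u. Vector_Spaces.linear scale scale u \<and> (\<forall>x. s x (u x) = 0)}"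

definition nilpotent_endo :: "('v::zero \<Rightarrow> 'v) \<Rightarrow> bool" where
  "nilpotent_endo u \<longleftrightarrow> (\<exists>k. \<forall>x. (u ^^ k) x = 0)"

definition nilpotent_subspace ::
  "('f::field \<Rightarrow> 'v::ab_group_add \<Rightarrow> 'v) \<Rightarrow> ('v \<Rightarrow> 'v) set \<Rightarrow> ('v \<Rightarrow> 'v) set \<Rightarrow> bool" where
  "nilpotent_subspace scale E S \<longleftrightarrow>
     S \<subseteq> E \<and> module.subspace (fun_scale scale) S \<and> (\<forall>u\<in>S. nilpotent_endo u)"

text \<open>Ordered bases of a space of dimension \<open>m\<close> are indexed by \<open>{..<m}\<close>, as rows and columns of matrices are.\<close>

definition is_ordered_basis :: "('f::field \<Rightarrow> 'v::ab_group_add \<Rightarrow> 'v) \<Rightarrow> nat \<Rightarrow> (nat \<Rightarrow> 'v) \<Rightarrow> bool" where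
  "is_ordered_basis scale m e \<longleftrightarrow>
     inj_on e {..<m} \<and> \<not> module.dependent scale (e ` {..<m}) \<and>
     module.span scale (e ` {..<m}) = UNIV"

definition gram_matrix :: "('v \<Rightarrow> 'v \<Rightarrow> 'f) \<Rightarrow> nat \<Rightarrow> (nat \<Rightarrow> 'v) \<Rightarrow> 'f mat" where
  "gram_matrix s m e = mat m m (\<lambda>(i, j). s (e i) (e j))"

definition symplectic_basis ::
  "('f::field \<Rightarrow> 'v::ab_group_add \<Rightarrow> 'v) \<Rightarrow> ('v \<Rightarrow> 'v \<Rightarrow> 'f) \<Rightarrow> nat \<Rightarrow> (nat \<Rightarrow> 'v) \<Rightarrow> bool" where
  "symplectic_basis scale s n e \<longleftrightarrow>
     is_ordered_basis scale (2 * n) e \<and>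
     gram_matrix s (2 * n) e = four_block_mat (0\<^sub>m n n) (1\<^sub>m n) (- 1\<^sub>m n) (0\<^sub>m n n)"

text \<open>Column \<open>j\<close> holds the coordinates of \<open>u (e j)\<close>.\<close>

definition matrix_of_endo ::
  "('f::field \<Rightarrow> 'v::ab_group_add \<Rightarrow> 'v) \<Rightarrow> nat \<Rightarrow> (nat \<Rightarrow> 'v) \<Rightarrow> ('v \<Rightarrow> 'v) \<Rightarrow> 'f mat" where
  "matrix_of_endo scale m e u =
     mat m m (\<lambda>(i, j). module.representation scale (e ` {..<m}) (u (e j)) (e i))"

definition strictly_upper_triangular_mats :: "nat \<Rightarrow> 'f::field mat set" where
  "strictly_upper_triangular_mats n =
     {U \<in> carrier_mat n n. \<forall>i<n. \<forall>j\<le>i. U $$ (i, j) = 0}"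

definition alternating_mats :: "nat \<Rightarrow> 'f::field mat set" where
  "alternating_mats n = {B \<in> carrier_mat n n. B\<^sup>T = - B \<and> (\<forall>i<n. B $$ (i, i) = 0)}"

definition NT_triangle_zero :: "nat \<Rightarrow> 'f::field mat set" where
  "NT_triangle_zero n =
     {four_block_mat U B (0\<^sub>m n n) (U\<^sup>T) | U B.
        U \<in> strictly_upper_triangular_mats n \<and> B \<in> alternating_mats n}"

end

theory Submission
  imports Defs "HOL-Computational_Algebra.Polynomial"
begin

text \<open>
  For a vector \<open>x \<noteq> 0\<close> let \<open>T x = F x + S x\<close> and let \<open>L x\<close> be the space of the \<open>y\<close> orthogonal to
  \<open>x\<close> for which the rank-two map \<open>wedge x y\<close>, sending \<open>z\<close> to \<open>s(x,z) y - s(y,z) x\<close>, lies in \<open>S\<close>.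
  A nilpotency argument shows that \<open>L x\<close> is orthogonal to \<open>T x\<close>. Since the elements of \<open>S\<close> that kill
  \<open>x\<close> induce a nilpotent space on the symplectic space \<open>x\<^sup>\<bottom>/F x\<close>, and those inducing \<open>0\<close> form a
  space isomorphic to \<open>L x/F x\<close>, the bound follows by induction on \<open>n\<close>.

  If the bound is attained, then \<open>T x\<close> and \<open>L x\<close> are orthogonal complements for every \<open>x \<noteq> 0\<close>, and
  the induced space is known by induction. Choose \<open>x\<close> with \<open>T x\<close> of least dimension. The known
  structure of the induced space shows that \<open>v t \<in> T x\<close> whenever \<open>v \<in> S\<close> is generic and \<open>t \<in> T x\<close>
  is orthogonal to \<open>v x\<close>. Comparing the alternating forms \<open>s(v x, v' x)\<close> and \<open>s(v y, v' x)\<close> on \<open>S\<close>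
  for \<open>y \<in> L x\<close> then forces \<open>T x\<close> to be totally isotropic, \<open>S\<close>-stable and equal to \<open>T y\<close> for each of
  its nonzero vectors \<open>y\<close>. The first-order part of \<open>(w + c v)\<^sup>q = 0\<close> now yields a nonzero vector
  of \<open>T x\<close> killed by all of \<open>S\<close>, and induction gives the triangular form.
\<close>

section \<open>Dimension and symplectic linear algebra\<close>

text \<open>
  \<open>dim\<close> has junk values on spaces without a finite basis, and the space of all functions \<open>V \<rightarrow> V\<close>
  need not have one; \<open>has_dim\<close> also records that a finite basis exists.
\<close>

definition has_dim :: "('f::field \<Rightarrow> 'v::ab_group_add \<Rightarrow> 'v) \<Rightarrow> 'v set \<Rightarrow> nat \<Rightarrow> bool" where
  "has_dim scale U k \<longleftrightarrow>
     (\<exists>B. finite B \<and> \<not> module.dependent scale B \<and> module.span scale B = U \<and> card B = k)"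

lemma (in vector_space) has_dim_imp_dim: "has_dim scale U k \<Longrightarrow> dim U = k"
  unfolding has_dim_def using dim_span_eq_card_independent by blast

lemma (in vector_space) has_dim_zero: "has_dim scale {0} 0"
  unfolding has_dim_def by (rule exI[of _ "{}"]) (simp add: independent_empty)

lemma (in finite_dimensional_vector_space) has_dim_dim: "subspace U \<Longrightarrow> has_dim scale U (dim U)"
  using basis_exists[of U] finiteI_independent span_subspace unfolding has_dim_def by metis

text \<open>Rank-nullity inside a possibly infinite-dimensional space, where finiteness comes from
  the kernel and the image: a basis \<open>C\<close> of the kernel and chosen preimages
  \<open>D\<close> of a basis of the image together form a basis of \<open>S\<close>.\<close>

lemma (in vector_space_pair) has_dim_kernel_image:
  assumes f: "Vector_Spaces.linear s1 s2 f" and S: "vs1.subspace S"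
    and ker: "has_dim s1 {u \<in> S. f u = 0} a" and im: "has_dim s2 (f ` S) b"
  shows "has_dim s1 S (a + b)"
proof -
  interpret f: Vector_Spaces.linear s1 s2 f by (rule f)
  obtain C where C: "finite C" "vs1.independent C" "vs1.span C = {u \<in> S. f u = 0}" "card C = a"
    using ker unfolding has_dim_def by blast
  obtain B where B: "finite B" "vs2.independent B" "vs2.span B = f ` S" "card B = b"
    using im unfolding has_dim_def by blast
  have "\<forall>y\<in>B. \<exists>x\<in>S. f x = y"
    using B(3) vs2.span_base[of _ B] by (metis image_iff)
  then obtain g where g: "\<And>y. y \<in> B \<Longrightarrow> g y \<in> S \<and> f (g y) = y"
    by metis
  define D where "D = g ` B"
  have inj: "inj_on g B" using g by (metis inj_onI)
  have fD: "f ` D = B" using g unfolding D_def by (force simp: image_iff)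
  have DS: "D \<subseteq> S" using g D_def by auto
  have CS: "C \<subseteq> S" using C(3) vs1.span_superset by blast
  have finD: "finite D" using B(1) D_def by simp
  have injD: "inj_on f D" using g unfolding D_def inj_on_def by auto
  have injsp: "inj_on f (vs1.span D)"
    using f.inj_on_span_iff_independent_image[of D] fD B(2) injD by simp
  have indD: "vs1.independent D"
  proof
    assume "vs1.dependent D"
    then obtain a where a: "a \<in> D" "a \<in> vs1.span (D - {a})" using vs1.dependent_def by auto
    then have "f a \<in> vs2.span (f ` (D - {a}))" by (simp add: f.span_image)
    moreover have "f ` (D - {a}) = f ` D - {f a}" using injD a(1) by (auto simp: inj_on_def)
    ultimately have "vs2.dependent B" using a(1) fD unfolding vs2.dependent_def by auto
    then show False using B(2) by simp
  qed
  have meet: "x = 0" if "x \<in> vs1.span C" "x \<in> vs1.span D" for x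
  proof -
    have "f x = f 0" using that C(3) by auto
    then show ?thesis using injsp that(2) vs1.span_zero by (meson inj_onD)
  qed
  have disj: "C \<inter> D = {}"
    using meet vs1.span_base C(2) vs1.dependent_zero by (metis disjoint_iff)
  have ind: "vs1.independent (C \<union> D)"
    unfolding vs1.dependent_finite[OF finite_UnI[OF C(1) finD]]
  proof clarify
    fix u v assume v: "v \<in> C \<union> D" "u v \<noteq> 0" and eq: "(\<Sum>v\<in>C \<union> D. s1 (u v) v) = 0"
    have sp: "(\<Sum>v\<in>C. s1 (u v) v) + (\<Sum>v\<in>D. s1 (u v) v) = 0"
      using eq by (simp add: sum.union_disjoint[OF C(1) finD disj])
    have "(\<Sum>v\<in>D. s1 (u v) v) = - (\<Sum>v\<in>C. s1 (u v) v)"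
      using sp by (simp add: eq_neg_iff_add_eq_0 add.commute)
    moreover have "- (\<Sum>v\<in>C. s1 (u v) v) \<in> vs1.span C"
      by (intro vs1.span_neg vs1.span_sum vs1.span_scale vs1.span_base)
    moreover have "(\<Sum>v\<in>D. s1 (u v) v) \<in> vs1.span D"
      by (intro vs1.span_sum vs1.span_scale vs1.span_base)
    ultimately have d0: "(\<Sum>v\<in>D. s1 (u v) v) = 0" using meet by metis
    then have c0: "(\<Sum>v\<in>C. s1 (u v) v) = 0" using sp by simp
    from v vs1.independentD[OF C(2) C(1) subset_refl c0] vs1.independentD[OF indD finD subset_refl d0]
    show False by blast
  qed
  have "vs1.span (C \<union> D) = S"
  proof
    show "vs1.span (C \<union> D) \<subseteq> S" using vs1.span_minimal[OF _ S] CS DS by auto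
    show "S \<subseteq> vs1.span (C \<union> D)"
    proof
      fix x assume x: "x \<in> S"
      have "f x \<in> vs2.span (f ` D)" using x B(3) fD by auto
      then obtain d where d: "d \<in> vs1.span D" "f x = f d" by (auto simp: f.span_image)
      have "d \<in> S" using d(1) vs1.span_minimal[OF DS S] by auto
      then have "x - d \<in> vs1.span C" using C(3) x vs1.subspace_diff[OF S] d(2) f.diff by auto
      then have "(x - d) + d \<in> vs1.span (C \<union> D)"
        using d(1) vs1.span_mono[of C "C \<union> D"] vs1.span_mono[of D "C \<union> D"] by (intro vs1.span_add) auto
      then show "x \<in> vs1.span (C \<union> D)" by simp
    qed
  qed
  moreover have "card (C \<union> D) = a + b"
    using card_Un_disjoint[OF C(1) finD disj] C(4) B(4) card_image[OF inj] D_def by simp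
  ultimately show ?thesis unfolding has_dim_def using ind C(1) finD by blast
qed

section \<open>Alternating endomorphisms and rank-two maps\<close>

locale fd_symplectic = symplectic_space scale s + finite_dimensional_vector_space scale Basis
  for scale :: "'f::field \<Rightarrow> 'v::ab_group_add \<Rightarrow> 'v" (infixr \<open>*s\<close> 75) and s Basis
begin

sublocale E: vector_space "fun_scale scale"
  by (rule vector_space_fun_scale) (rule vector_space_axioms)

sublocale EV: vector_space_pair "fun_scale scale" scale ..

sublocale EE: vector_space_pair "fun_scale scale" "fun_scale scale" ..

lemma s_add [simp]: "s (x + y) z = s x z + s y z" "s z (x + y) = s z x + s z y"
  using linear_left linear_right unfolding Vector_Spaces.linear_iff by auto

lemma s_scale [simp]: "s (c *s x) z = c * s x z" "s z (c *s x) = c * s z x"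
  using linear_left linear_right unfolding Vector_Spaces.linear_iff by auto

lemma s_zero [simp]: "s 0 z = 0" "s z 0 = 0"
  using s_scale(1)[of 0 0 z] s_scale(2)[of z 0 0] by simp_all

lemma s_minus [simp]: "s (- x) z = - s x z" "s z (- x) = - s z x"
  using s_add(1)[of x "-x" z] s_add(2)[of z x "-x"] by (simp_all add: eq_neg_iff_add_eq_0 add.commute)

lemma s_diff [simp]: "s (x - y) z = s x z - s y z" "s z (x - y) = s z x - s z y"
  using s_add(1)[of x "-y" z] s_add(2)[of z x "-y"] by auto

declare alternating [simp]

lemma s_swap: "s y x = - s x y"
proof -
  have "s x (x + y) + s y (x + y) = 0" using alternating[of "x + y"] s_add(1)[of x y "x + y"] by metis
  then have "s y x + s x y = 0" by (simp add: add.commute)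
  then show ?thesis by (simp add: eq_neg_iff_add_eq_0)
qed

lemma s_eq_0_swap: "s y x = 0 \<longleftrightarrow> s x y = 0"
  using s_swap[of y x] by simp

lemma nondegenerate': "(\<And>y. s y x = 0) \<Longrightarrow> x = 0"
  using nondegenerate[of x] s_eq_0_swap by blast

text \<open>When \<open>s\<close> identifies V with its dual, alternating endomorphisms become
  bivectors; up to sign this one is the decomposable bivector of \<open>x\<close> and
  \<open>y\<close>.\<close>

definition wedge :: "'v \<Rightarrow> 'v \<Rightarrow> 'v \<Rightarrow> 'v" where
  "wedge x y = (\<lambda>z. s x z *s y - s y z *s x)"

abbreviation A where "A \<equiv> alternating_endos scale s"

lemma alternating_endosD:
  assumes "u \<in> A"
  shows "Vector_Spaces.linear scale scale u" "s x (u x) = 0" "s x (u y) = s (u x) y"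
    "u (x + y) = u x + u y" "u (x - y) = u x - u y" "u (c *s x) = c *s u x" "u 0 = 0" "u (- x) = - u x"
proof -
  show l: "Vector_Spaces.linear scale scale u" and a: "\<And>x. s x (u x) = 0"
    using assms by (auto simp: alternating_endos_def)
  interpret Vector_Spaces.linear scale scale u by (rule l)
  show "u (x + y) = u x + u y" "u (x - y) = u x - u y" "u (c *s x) = c *s u x" "u 0 = 0" "u (- x) = - u x"
    by (simp_all add: add diff scale neg)
  have "s x (u y) + s y (u x) = 0"
    using a[of "x + y"] a[of x] a[of y] by (simp add: add add.commute)
  then show "s x (u y) = s (u x) y" using s_swap[of y "u x"] by (simp add: eq_neg_iff_add_eq_0)
qed

lemma wedge_alternating: "wedge x y \<in> A"
proof -
  have "s z (wedge x y z) = 0" for z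
    using s_swap[of x z] s_swap[of y z] by (simp add: wedge_def)
  moreover have "Vector_Spaces.linear scale scale (wedge x y)"
    by (auto simp: Vector_Spaces.linear_iff vector_space_axioms wedge_def algebra_simps)
  ultimately show ?thesis by (simp add: alternating_endos_def)
qed

lemma wedge_add: "wedge x (y + z) = wedge x y + wedge x z"
  and wedge_scale: "wedge x (c *s y) = fun_scale scale c (wedge x y)"
  and wedge_diff: "wedge x (y - z) = wedge x y - wedge x z"
  and wedge_self [simp]: "wedge x x = 0"
  by (auto simp: wedge_def fun_eq_iff algebra_simps fun_scale_def)

lemma subspace_wedge: "E.subspace S \<Longrightarrow> subspace {y. wedge x y \<in> S}"
  by (rule subspaceI)
    (auto simp: wedge_add wedge_scale E.subspace_add E.subspace_scale E.subspace_0
      wedge_def[of x 0] zero_fun_def[symmetric])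

text \<open>Each functional \<open>s c\<close> lowers the dimension by at most one: a vector
  \<open>w\<close> with \<open>s c w \<noteq> 0\<close> spans the rest modulo the kernel of the
  functional.\<close>

lemma dim_perp_finite:
  assumes "finite C" "subspace W"
  shows "subspace {y \<in> W. \<forall>c\<in>C. s c y = 0}" "dim W \<le> dim {y \<in> W. \<forall>c\<in>C. s c y = 0} + card C"
proof -
  show sub: "subspace {y \<in> W. \<forall>c\<in>C. s c y = 0}" for C
    using assms(2) by (auto simp: subspace_def)
  show "dim W \<le> dim {y \<in> W. \<forall>c\<in>C. s c y = 0} + card C"
    using assms(1)
  proof induction
    case empty then show ?case by simp
  next
    case (insert c C)
    let ?K = "{y \<in> W. \<forall>c\<in>C. s c y = 0}" and ?L = "{y \<in> W. \<forall>c\<in>insert c C. s c y = 0}"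
    have "dim ?K \<le> dim ?L + 1"
    proof (cases "?K \<subseteq> ?L")
      case True then show ?thesis using dim_subset[of ?K ?L] by linarith
    next
      case False
      then obtain w where w: "w \<in> ?K" "s c w \<noteq> 0" by auto
      have "?K \<subseteq> span (insert w ?L)"
      proof
        fix y assume y: "y \<in> ?K"
        have "y - (s c y / s c w) *s w \<in> ?L"
          using y w subspace_diff[OF assms(2)] subspace_scale[OF assms(2)] by simp
        then show "y \<in> span (insert w ?L)" unfolding span_breakdown_eq by (intro exI) (rule span_base)
      qed
      then have "dim ?K \<le> dim (span (insert w ?L))" by (rule dim_subset)
      also have "\<dots> \<le> dim ?L + 1" by (simp add: dim_insert)
      finally show ?thesis .
    qed
    then show ?case using insert by simp
  qed
qed

section \<open>Orthogonal complements in non-degenerate subspaces\<close>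

definition nondeg :: "'v set \<Rightarrow> bool" where
  "nondeg H \<longleftrightarrow> subspace H \<and> (\<forall>x\<in>H. (\<forall>y\<in>H. s x y = 0) \<longrightarrow> x = 0)"

definition perp :: "'v set \<Rightarrow> 'v set \<Rightarrow> 'v set" where
  "perp H U = {y \<in> H. \<forall>u\<in>U. s u y = 0}"

lemma subspace_perp: "subspace H \<Longrightarrow> subspace (perp H U)"
  by (auto simp: subspace_def perp_def)

lemma perp_span: "perp H (span U) = perp H U"
proof
  show "perp H (span U) \<subseteq> perp H U" by (auto simp: perp_def span_base)
  show "perp H U \<subseteq> perp H (span U)"
  proof
    fix y assume y: "y \<in> perp H U"
    have "subspace {u. s u y = 0}" by (auto simp: subspace_def)
    then have "span U \<subseteq> {u. s u y = 0}" using y by (intro span_minimal) (auto simp: perp_def)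
    then show "y \<in> perp H (span U)" using y by (auto simp: perp_def)
  qed
qed

lemma dim_perp:
  assumes H: "nondeg H" and U: "subspace U" "U \<subseteq> H"
  shows "dim (perp H U) + dim U = dim H"
proof -
  have sH: "subspace H" using H nondeg_def by simp
  obtain B where B: "B \<subseteq> U" "\<not> dependent B" "U \<subseteq> span B" "card B = dim U"
    using basis_exists by blast
  obtain C where C: "B \<subseteq> C" "C \<subseteq> H" "\<not> dependent C" "H \<subseteq> span C"
    using maximal_independent_subset_extend[OF order_trans[OF B(1) U(2)] B(2)] by blast
  have fin: "finite B" "finite C" using B C finiteI_independent by auto
  have cC: "card C = dim H" using C basis_card_eq_dim by blast
  have spB: "span B = U" using B U span_subspace by blast
  have pB: "perp H U = perp H B" using perp_span[of H B] spB by simp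
  have "dim H \<le> dim (perp H B) + card B"
    using dim_perp_finite(2)[OF fin(1) sH] by (simp add: perp_def)
  \<comment> \<open>The remaining conditions, from \<open>C - B\<close>, cut the complement of
    \<open>U\<close> down to 0, which bounds its dimension from above by
    \<open>card (C - B)\<close>.\<close>
  moreover have "dim (perp H B) \<le> dim {y \<in> perp H B. \<forall>c\<in>C - B. s c y = 0} + card (C - B)"
    using dim_perp_finite(2)[of "C - B" "perp H B"] fin subspace_perp[OF sH] by simp
  moreover have "{y \<in> perp H B. \<forall>c\<in>C - B. s c y = 0} \<subseteq> {0}"
  proof
    fix y assume y: "y \<in> {y \<in> perp H B. \<forall>c\<in>C - B. s c y = 0}"
    then have "y \<in> perp H C" by (auto simp: perp_def)
    then have "y \<in> perp H (span C)" by (simp add: perp_span)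
    then have "\<forall>z\<in>H. s z y = 0" using C(4) by (auto simp: perp_def)
    then have "\<forall>z\<in>H. s y z = 0" using s_eq_0_swap by blast
    then show "y \<in> {0}" using H y by (auto simp: nondeg_def perp_def)
  qed
  moreover have "card (C - B) = dim H - dim U"
    using card_Diff_subset[OF fin(1) C(1)] cC B(4) by simp
  moreover have "dim U \<le> dim H" using dim_subset U(2) by blast
  moreover have "dim {y \<in> perp H B. \<forall>c\<in>C - B. s c y = 0} = 0"
    using calculation(3) by (simp add: dim_eq_0)
  ultimately show ?thesis using pB B(4) by simp
qed

lemma perp_perp:
  assumes H: "nondeg H" and U: "subspace U" "U \<subseteq> H"
  shows "perp H (perp H U) = U"
proof -
  have sH: "subspace H" using H nondeg_def by simp
  have "U \<subseteq> perp H (perp H U)"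
    using U(2) s_eq_0_swap by (auto simp: perp_def)
  moreover have "dim (perp H (perp H U)) = dim U"
    using dim_perp[OF H subspace_perp[OF sH, of U]] dim_perp[OF H U] by (simp add: perp_def)
  ultimately show ?thesis
    using subspace_dim_equal[OF U(1) subspace_perp[OF sH]] by (metis order_refl)
qed

end

section \<open>Nilpotency arguments\<close>

text \<open>The recurrence says (1 - t \<Phi>) (1 + t \<Psi>) = 1 for the generating functions. By
  \<open>ev\<close> both factors are polynomials, and a unit of a polynomial ring over a field is
  constant.\<close>

lemma quasi_inverse_sequences_zero:
  fixes \<phi> \<psi> :: "nat \<Rightarrow> 'f::field"
  assumes rec: "\<And>j. \<phi> j = \<psi> j - (\<Sum>i<j. \<phi> i * \<psi> (j - Suc i))"
    and ev: "\<And>j. K \<le> j \<Longrightarrow> \<phi> j = 0" "\<And>j. K \<le> j \<Longrightarrow> \<psi> j = 0"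
  shows "\<psi> j = 0"
proof (rule ccontr)
  have last: "\<exists>a. g a \<noteq> 0 \<and> (\<forall>j>a. g j = 0)"
    if "\<And>j. K \<le> j \<Longrightarrow> g j = 0" "g i \<noteq> 0" for g :: "nat \<Rightarrow> 'f" and i
  proof -
    have "j < K" if "g j \<noteq> 0" for j
      by (rule ccontr) (use that \<open>\<And>j. K \<le> j \<Longrightarrow> g j = 0\<close>[of j] in simp)
    then have fin: "finite {j. g j \<noteq> 0}"
      by (intro finite_subset[OF _ finite_lessThan[of K]]) auto
    have "Max {j. g j \<noteq> 0} \<in> {j. g j \<noteq> 0}" using that(2) by (intro Max_in fin) auto
    moreover have "g j = 0" if "j > Max {j. g j \<noteq> 0}" for j
      using Max_ge[OF fin, of j] that by auto
    ultimately show ?thesis by blast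
  qed
  assume "\<psi> j \<noteq> 0"
  then obtain b where b: "\<psi> b \<noteq> 0" "\<And>j. j > b \<Longrightarrow> \<psi> j = 0" using last[of \<psi>] ev by metis
  have "\<exists>i. \<phi> i \<noteq> 0"
  proof (rule ccontr)
    assume "\<nexists>i. \<phi> i \<noteq> 0"
    then show False using rec[of b] b(1) by simp
  qed
  then obtain a where a: "\<phi> a \<noteq> 0" "\<And>j. j > a \<Longrightarrow> \<phi> j = 0" using last[of \<phi>] ev by metis
  \<comment> \<open>In the convolution at index \<open>Suc (a + b)\<close> only the product of the
    two leading coefficients survives.\<close>
  have "\<phi> i * \<psi> (a + b - i) = (if i = a then \<phi> a * \<psi> b else 0)" if "i < Suc (a + b)" for i
    using a(2)[of i] b(2)[of "a + b - i"] that by (cases i a rule: linorder_cases) auto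
  then have "(\<Sum>i<Suc (a + b). \<phi> i * \<psi> (Suc (a + b) - Suc i)) = \<phi> a * \<psi> b"
    by (simp add: sum.delta)
  moreover have "\<phi> (Suc (a + b)) = 0" "\<psi> (Suc (a + b)) = 0" using a b by auto
  ultimately show False using rec[of "Suc (a + b)"] a(1) b(1) by simp
qed

context fd_symplectic
begin

text \<open>Powers of \<open>u\<close> are self-adjoint, so an orbit is totally isotropic: moving
  half of the power across leaves \<open>s z z\<close> for an even exponent and
  \<open>s z (u z)\<close> for an odd one. Both vanish in every characteristic.\<close>

lemma funpow_alternating:
  assumes "u \<in> A"
  shows "(u ^^ k) 0 = 0" "s ((u ^^ i) x) y = s x ((u ^^ i) y)" "s ((u ^^ i) x) ((u ^^ j) x) = 0"
proof -
  show "(u ^^ k) 0 = 0" for k by (induction k) (auto simp: alternating_endosD[OF assms])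
  show adj: "s ((u ^^ i) x) y = s x ((u ^^ i) y)" for i x y
    by (induction i arbitrary: x y)
      (auto simp: alternating_endosD(3)[OF assms, symmetric] funpow_swap1)
  have "s x ((u ^^ k) x) = 0" for k x
  proof (cases "even k")
    case True
    then obtain l where "k = l + l" by (metis evenE mult_2)
    then have "s x ((u ^^ k) x) = s x ((u ^^ l) ((u ^^ l) x))" by (simp add: funpow_add)
    also have "\<dots> = s ((u ^^ l) x) ((u ^^ l) x)" by (rule adj[symmetric])
    finally show ?thesis by simp
  next
    case False
    then obtain l where "k = l + Suc l" by (metis oddE mult_2 add_Suc_right Suc_eq_plus1)
    then have "s x ((u ^^ k) x) = s x ((u ^^ l) (u ((u ^^ l) x)))" by (simp add: funpow_add funpow_swap1)
    also have "\<dots> = s ((u ^^ l) x) (u ((u ^^ l) x))" by (rule adj[symmetric])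
    finally show ?thesis using alternating_endosD(2)[OF assms] by simp
  qed
  from this[of x "i + j"] show "s ((u ^^ i) x) ((u ^^ j) x) = 0" by (simp add: adj funpow_add)
qed

lemma nilpotent_eventually:
  assumes "u \<in> A" "nilpotent_endo u"
  obtains K where "\<And>j x. K \<le> j \<Longrightarrow> (u ^^ j) x = 0"
proof -
  obtain K where K: "\<And>x. (u ^^ K) x = 0" using assms(2) nilpotent_endo_def by auto
  have "(u ^^ j) x = 0" if "K \<le> j" for j x
  proof -
    have "(u ^^ j) x = (u ^^ (j - K)) ((u ^^ K) x)"
      using that by (metis funpow_add le_add_diff_inverse2 comp_apply)
    then show ?thesis using K funpow_alternating(1)[OF assms(1)] by simp
  qed
  then show ?thesis using that by blast
qed

lemma alternating_closed: "u \<in> A \<Longrightarrow> v \<in> A \<Longrightarrow> u + v \<in> A"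
  by (auto simp: alternating_endos_def Vector_Spaces.linear_iff algebra_simps)

text \<open>With \<open>N = w + wedge x y\<close>, the generating functions \<open>\<Phi>\<close> of \<open>s y (N\<^sup>j x)\<close> and \<open>\<Psi>\<close> of
  \<open>s y (w\<^sup>j x)\<close> satisfy \<open>(1 - t \<Phi>) (1 + t \<Psi>) = 1\<close>; both are polynomials, hence zero.\<close>

lemma wedge_orthogonal_orbit:
  assumes w: "w \<in> A" "nilpotent_endo w" and N: "nilpotent_endo (w + wedge x y)"
  shows "s y ((w ^^ k) x) = 0"
proof -
  define N where "N = w + wedge x y"
  have NA: "N \<in> A" unfolding N_def by (intro alternating_closed w wedge_alternating)
  define \<phi> where "\<phi> j = s y ((N ^^ j) x)" for j
  define \<psi> where "\<psi> j = s y ((w ^^ j) x)" for j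
  \<comment> \<open>Along the orbit of \<open>x\<close> the perturbation only subtracts
    \<open>\<phi> j *s x\<close>, since \<open>s x ((N ^^ j) x) = 0\<close>; unrolling gives a
    variation-of-constants formula.\<close>
  have *: "(N ^^ j) x = (w ^^ j) x - (\<Sum>i<j. \<phi> i *s (w ^^ (j - Suc i)) x)" for j
  proof (induction j)
    case (Suc j)
    interpret w: Vector_Spaces.linear scale scale w by (rule alternating_endosD(1)[OF w(1)])
    have 0: "s x ((N ^^ j) x) = 0" using funpow_alternating(3)[OF NA, of 0 x j] by simp
    have "(N ^^ Suc j) x = w ((N ^^ j) x) - \<phi> j *s x"
      using 0 by (simp add: N_def wedge_def \<phi>_def)
    also have "w ((N ^^ j) x) = (w ^^ Suc j) x - (\<Sum>i<j. \<phi> i *s w ((w ^^ (j - Suc i)) x))"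
      by (subst Suc) (simp add: w.diff w.sum w.scale)
    also have "(\<Sum>i<j. \<phi> i *s w ((w ^^ (j - Suc i)) x)) = (\<Sum>i<j. \<phi> i *s (w ^^ (Suc j - Suc i)) x)"
    proof (rule sum.cong)
      fix i assume "i \<in> {..<j}"
      then have "Suc j - Suc i = Suc (j - Suc i)" by auto
      then show "\<phi> i *s w ((w ^^ (j - Suc i)) x) = \<phi> i *s (w ^^ (Suc j - Suc i)) x" by simp
    qed simp
    finally show ?case by (simp add: algebra_simps)
  qed simp
  have s_sum: "s y (sum g I) = (\<Sum>i\<in>I. s y (g i))" for g :: "nat \<Rightarrow> 'v" and I
    by (induction I rule: infinite_finite_induct) auto
  have rec: "\<phi> j = \<psi> j - (\<Sum>i<j. \<phi> i * \<psi> (j - Suc i))" for j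
  proof -
    have "s y ((N ^^ j) x) = s y ((w ^^ j) x - (\<Sum>i<j. \<phi> i *s (w ^^ (j - Suc i)) x))"
      using * by simp
    then show ?thesis by (simp add: \<psi>_def s_sum flip: \<phi>_def)
  qed
  obtain K1 where K1: "\<And>j x. K1 \<le> j \<Longrightarrow> (N ^^ j) x = 0"
    using nilpotent_eventually[OF NA] N N_def by metis
  obtain K2 where K2: "\<And>j x. K2 \<le> j \<Longrightarrow> (w ^^ j) x = 0"
    using nilpotent_eventually[OF w] by metis
  have "\<phi> j = 0" "\<psi> j = 0" if "max K1 K2 \<le> j" for j
    using that K1[of j x] K2[of j x] by (simp_all add: \<phi>_def \<psi>_def)
  from quasi_inverse_sequences_zero[of \<phi> \<psi>, OF rec this] have "\<psi> k = 0" .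
  then show ?thesis by (simp add: \<psi>_def)
qed

lemma pencil_power_expansion:
  assumes v: "v \<in> A" and w: "w \<in> A" and U: "subspace U" "v ` U \<subseteq> U" "w ` U \<subseteq> U" and z: "z \<in> U"
  shows "\<exists>a. (\<forall>i. a i \<in> U) \<and> (\<forall>i>k. a i = 0) \<and> a k = (v ^^ k) z \<and> a 0 = (w ^^ k) z \<and>
    (0 < k \<longrightarrow> a 1 - v ((w ^^ (k - 1)) z) \<in> w ` U) \<and>
    (\<forall>c. ((\<lambda>y. w y + c *s v y) ^^ k) z = (\<Sum>i\<le>k. c ^ i *s a i))"
proof (induction k)
  case 0
  show ?case
    by (rule exI[of _ "\<lambda>i. if i = 0 then z else 0"]) (use z subspace_0[OF U(1)] in auto)
next
  case (Suc k)
  interpret w: Vector_Spaces.linear scale scale w by (rule alternating_endosD(1)[OF w])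
  interpret v: Vector_Spaces.linear scale scale v by (rule alternating_endosD(1)[OF v])
  obtain a where a: "\<And>i. a i \<in> U" "\<And>i. i > k \<Longrightarrow> a i = 0" "a k = (v ^^ k) z" "a 0 = (w ^^ k) z"
    "\<And>c. ((\<lambda>y. w y + c *s v y) ^^ k) z = (\<Sum>i\<le>k. c ^ i *s a i)"
    using Suc by blast
  define b where "b i = w (a i) + (case i of 0 \<Rightarrow> 0 | Suc j \<Rightarrow> v (a j))" for i
  have 1: "b i \<in> U" for i
    using a(1) U subspace_0[OF U(1)] unfolding b_def
    by (intro subspace_add[OF U(1)]) (auto split: nat.split)
  have 2: "b i = 0" if "i > Suc k" for i
    using that a(2) by (cases i) (auto simp: b_def)
  have 3: "b (Suc k) = (v ^^ Suc k) z" using a(2)[of "Suc k"] a(3) by (simp add: b_def)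
  have 4: "b 0 = (w ^^ Suc k) z" using a(4) by (simp add: b_def)
  have "b 1 - v ((w ^^ k) z) = w (a 1)" using a(4) by (simp add: b_def)
  then have 5: "b 1 - v ((w ^^ (Suc k - 1)) z) \<in> w ` U" using a(1) by simp
  have 6: "((\<lambda>y. w y + c *s v y) ^^ Suc k) z = (\<Sum>i\<le>Suc k. c ^ i *s b i)" for c
  proof -
    have "((\<lambda>y. w y + c *s v y) ^^ Suc k) z
        = (\<Sum>i\<le>k. c ^ i *s w (a i)) + (\<Sum>i\<le>k. c ^ Suc i *s v (a i))"
      by (simp add: a(5) w.sum v.sum w.scale v.scale scale_sum_right)
    also have "(\<Sum>i\<le>k. c ^ i *s w (a i)) = (\<Sum>i\<le>Suc k. c ^ i *s w (a i))"
      using a(2)[of "Suc k"] by simp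
    also have "(\<Sum>i\<le>k. c ^ Suc i *s v (a i)) =
        (\<Sum>i\<le>Suc k. c ^ i *s (case i of 0 \<Rightarrow> 0 | Suc j \<Rightarrow> v (a j)))"
      using sum.atMost_Suc_shift[of "\<lambda>i. c ^ i *s (case i of 0 \<Rightarrow> 0 | Suc j \<Rightarrow> v (a j))" k] by simp
    finally show ?thesis by (simp only: b_def scale_right_distrib sum.distrib)
  qed
  show ?case using 1 2 3 4 5 6 by blast
qed

text \<open>The power of the pencil vanishes for every scalar \<open>c\<close>, and the field is
  large enough to make the coefficient of \<open>c\<close> vanish as well. Pairing with a vector
  \<open>y\<close> reduces this to scalar polynomials.\<close>

lemma first_order:
  assumes v: "v \<in> A" and w: "w \<in> A" and U: "subspace U" "v ` U \<subseteq> U" "w ` U \<subseteq> U" and z: "z \<in> U"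
    and nil: "\<And>c. ((\<lambda>y. w y + c *s v y) ^^ q) z = 0" "(v ^^ q) z = 0"
    and q: "0 < q" "infinite (UNIV :: 'f set) \<or> q \<le> card (UNIV :: 'f set)"
  shows "v ((w ^^ (q - 1)) z) \<in> w ` U"
proof -
  interpret w: Vector_Spaces.linear scale scale w by (rule alternating_endosD(1)[OF w])
  obtain a where a: "\<And>i. a i \<in> U" "\<And>i. i > q \<Longrightarrow> a i = 0" "a q = (v ^^ q) z"
    "a 1 - v ((w ^^ (q - 1)) z) \<in> w ` U"
    "\<And>c. ((\<lambda>y. w y + c *s v y) ^^ q) z = (\<Sum>i\<le>q. c ^ i *s a i)"
    using pencil_power_expansion[OF v w U z, of q] q(1) by blast
  have "a 1 = 0"
  proof (rule nondegenerate')
    fix y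
    have s_sum: "s y (sum g I) = (\<Sum>i\<in>I. s y (g i))" for g :: "nat \<Rightarrow> 'v" and I
      by (induction I rule: infinite_finite_induct) auto
    define p where "p = (\<Sum>i\<le>q. monom (s y (a i)) i)"
    have co: "coeff p j = s y (a j)" for j
      using a(2)[of j] by (auto simp: p_def coeff_sum sum.delta if_distrib not_le cong: if_cong)
    have root: "poly p c = 0" for c
    proof -
      have "poly p c = s y (\<Sum>i\<le>q. c ^ i *s a i)"
        by (simp add: p_def poly_sum poly_monom s_sum mult.commute)
      then show ?thesis using a(5) nil(1) by simp
    qed
    have "p = 0"
    proof (rule ccontr)
      assume "p \<noteq> 0"
      \<comment> \<open>The top coefficient vanishes by \<open>(v ^^ q) z = 0\<close>, so the degree
        is below \<open>q\<close> and \<open>q\<close> scalars suffice.\<close>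
      have "degree p \<le> q - 1"
        using co a(2,3) nil(2) by (intro degree_le) (metis Suc_pred' Suc_leI le_neq_implies_less not_le q(1) s_zero(2) Suc_le_eq)
      moreover have "finite {c. poly p c = 0}" "card {c. poly p c = 0} \<le> degree p"
        using poly_roots_finite[OF \<open>p \<noteq> 0\<close>] card_poly_roots_bound[OF \<open>p \<noteq> 0\<close>] by auto
      ultimately show False using root q by auto
    qed
    then show "s y (a 1) = 0" using co[of 1] by simp
  qed
  then have "- v ((w ^^ (q - 1)) z) \<in> w ` U" using a(4) by simp
  then obtain t where "t \<in> U" "- v ((w ^^ (q - 1)) z) = w t" by auto
  then have "v ((w ^^ (q - 1)) z) = w (- t)" "- t \<in> U"
    using U(1) subspace_neg by (auto simp: w.neg minus_equation_iff)
  then show ?thesis by blast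
qed

section \<open>Projection to a smaller symplectic space and the triangular model\<close>

text \<open>When \<open>s x f = 1\<close>, this is the orthogonal projection along the hyperbolic
  plane of \<open>x\<close> and \<open>f\<close>.\<close>

definition proj :: "'v \<Rightarrow> 'v \<Rightarrow> 'v \<Rightarrow> 'v" where
  "proj x f = (\<lambda>z. z - s x z *s f + s f z *s x)"

lemma proj_linear [simp]:
  "proj x f (y + z) = proj x f y + proj x f z" "proj x f (c *s z) = c *s proj x f z" "proj x f 0 = 0"
  by (simp_all add: proj_def algebra_simps)

lemma proj_diff: "proj x f (y - z) = proj x f y - proj x f z"
  by (simp add: proj_def algebra_simps)

lemma proj_minus [simp]: "proj x f (- z) = - proj x f z"
  by (simp add: proj_def algebra_simps)

lemma proj_eq: "z = proj x f z + s x z *s f - s f z *s x"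
  by (simp add: proj_def)

lemma proj_adjoint: "s (proj x f z) y = s z (proj x f y)"
  using s_swap[of z x] s_swap[of z f] by (simp add: proj_def)

context
  fixes x f assumes xf: "s x f = 1"
begin

lemma s_fx: "s f x = - 1"
  using s_swap[of f x] xf by simp

lemma s_proj [simp]: "s x (proj x f z) = 0" "s f (proj x f z) = 0" "s (proj x f z) x = 0" "s (proj x f z) f = 0"
proof -
  show *: "s x (proj x f z) = 0" "s f (proj x f z) = 0"
    by (simp_all add: proj_def xf s_fx)
  show "s (proj x f z) x = 0" "s (proj x f z) f = 0"
    using * s_eq_0_swap by blast+
qed

lemma proj_simps [simp]: "proj x f x = 0" "proj x f f = 0" "proj x f (proj x f z) = proj x f z"
  using s_proj by (simp_all add: proj_def xf s_fx)

lemma proj_in_perp: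
  assumes "subspace H" "x \<in> H" "f \<in> H" "z \<in> H"
  shows "proj x f z \<in> perp H {x, f}"
proof -
  have "proj x f z \<in> H"
    unfolding proj_def
    by (rule subspace_add[OF assms(1) subspace_diff[OF assms(1,4)] subspace_scale[OF assms(1,2)]])
      (rule subspace_scale[OF assms(1,3)])
  then show ?thesis by (simp add: perp_def)
qed

lemma nondeg_perp_pair:
  assumes H: "nondeg H" and xH: "x \<in> H" "f \<in> H"
  shows "nondeg (perp H {x, f})" "dim H = dim (perp H {x, f}) + 2"
proof -
  have sH: "subspace H" using H nondeg_def by simp
  show "nondeg (perp H {x, f})"
    unfolding nondeg_def
  proof (intro conjI ballI impI)
    show "subspace (perp H {x, f})" by (rule subspace_perp[OF sH])
    fix z assume z: "z \<in> perp H {x, f}" "\<forall>y\<in>perp H {x, f}. s z y = 0"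
    have "s z y = 0" if "y \<in> H" for y
    proof -
      have "s z (proj x f y) = 0" using z(2) proj_in_perp[OF sH xH that] by blast
      moreover have "s z x = 0" "s z f = 0" using z(1) s_eq_0_swap by (auto simp: perp_def)
      ultimately show ?thesis by (simp add: proj_def)
    qed
    then show "z = 0" using H z(1) by (auto simp: nondeg_def perp_def)
  qed
  have "x \<noteq> 0" using xf by auto
  moreover have "f \<notin> span {x}" using xf by (auto simp: span_singleton)
  ultimately have "dim (span {x, f}) = 2" by (subst insert_commute) (simp add: dim_insert)
  moreover have "span {x, f} \<subseteq> H" using span_minimal[of "{x, f}" H] sH xH by simp
  ultimately show "dim H = dim (perp H {x, f}) + 2"
    using dim_perp[OF H subspace_span, of "{x, f}"] by (simp add: perp_span)
qed

text \<open>Self-adjointness and \<open>u x = 0\<close> make the range of \<open>u\<close>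
  orthogonal to \<open>x\<close>. Besides the induced map on the complement, only \<open>u f\<close>
  is left to record, and it enters through a rank-two map.\<close>

lemma alternating_decomposition:
  assumes u: "u \<in> A" and ux: "u x = 0"
  shows "u z = proj x f (u (proj x f z)) + wedge x (u f) z"
proof -
  note ul = alternating_endosD[OF u]
  have *: "s x (u y) = 0" for y using ul(3)[of x y] ux by simp
  have uz: "u z = u (proj x f z) + s x z *s u f"
    by (subst proj_eq[of z x f]) (simp only: ul ux scale_zero_right diff_zero)
  have "s (u f) z = s (u f) (proj x f z)"
    by (subst proj_eq[of z x f]) (use * ul(2)[of f] s_eq_0_swap in \<open>simp add: ul(3)[symmetric] ux\<close>)
  then have "s f (u (proj x f z)) = s (u f) z" by (simp add: ul(3))
  then have "u (proj x f z) = proj x f (u (proj x f z)) - s (u f) z *s x"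
    using * by (simp add: proj_def)
  then show ?thesis using uz by (simp add: wedge_def algebra_simps)
qed

lemma proj_conj_alternating:
  assumes u: "u \<in> A"
  shows "proj x f \<circ> u \<circ> proj x f \<in> A"
  unfolding alternating_endos_def
proof (intro CollectI conjI allI)
  note ul = alternating_endosD[OF u]
  show "Vector_Spaces.linear scale scale (proj x f \<circ> u \<circ> proj x f)"
    by (auto simp: Vector_Spaces.linear_iff vector_space_axioms ul)
  show "s z ((proj x f \<circ> u \<circ> proj x f) z) = 0" for z
    using ul(2)[of "proj x f z"] by (simp add: proj_adjoint[symmetric])
qed

text \<open>The orthogonal of \<open>x\<close> is stable under \<open>u\<close>, and there the
  projection only changes vectors by multiples of \<open>x\<close>, which \<open>u\<close> kills. So
  powers of the compression are compressions of powers.\<close>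

lemma proj_conj_nilpotent:
  assumes u: "u \<in> A" "nilpotent_endo u" and ux: "u x = 0"
  shows "nilpotent_endo (proj x f \<circ> u \<circ> proj x f)"
proof -
  note ul = alternating_endosD[OF u(1)]
  have perp: "s x ((u ^^ k) (proj x f z)) = 0" for k z
    using ul(3)[of x] ux by (cases k) auto
  have up: "u (proj x f y) = u y" if "s x y = 0" for y
    using that by (simp add: proj_def ul ux)
  have "((proj x f \<circ> u \<circ> proj x f) ^^ Suc k) z = proj x f ((u ^^ Suc k) (proj x f z))" for k z
  proof (induction k)
    case (Suc k)
    have "((proj x f \<circ> u \<circ> proj x f) ^^ Suc (Suc k)) z
        = (proj x f \<circ> u \<circ> proj x f) (((proj x f \<circ> u \<circ> proj x f) ^^ Suc k) z)" by simp
    also have "\<dots> = proj x f (u (proj x f ((u ^^ Suc k) (proj x f z))))"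
      by (simp only: Suc comp_apply proj_simps)
    also have "\<dots> = proj x f ((u ^^ Suc (Suc k)) (proj x f z))"
      using up[OF perp[of "Suc k" z]] by simp
    finally show ?case .
  qed simp
  moreover obtain K where "\<And>j z. K \<le> j \<Longrightarrow> (u ^^ j) z = 0" using nilpotent_eventually[OF u] by metis
  ultimately have "((proj x f \<circ> u \<circ> proj x f) ^^ Suc K) z = 0" for z
    by (metis le_SucI order_refl proj_linear(3))
  then show ?thesis unfolding nilpotent_endo_def by blast
qed

end

section \<open>The triangular model and its generic vectors\<close>

lemma linear_eval: "Vector_Spaces.linear (fun_scale scale) scale (\<lambda>u. u x)"
  by (simp add: Vector_Spaces.linear_iff vector_space_axioms E.vector_space_axioms fun_scale_def)

lemma linear_proj_conj:
  "Vector_Spaces.linear (fun_scale scale) (fun_scale scale) (\<lambda>u. proj x f \<circ> u \<circ> proj x f)"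
  by (simp add: Vector_Spaces.linear_iff E.vector_space_axioms fun_scale_def fun_eq_iff)

lemma linear_image_subspace:
  assumes "E.subspace S" shows "subspace ((\<lambda>u. u x) ` S)"
  using module_hom.subspace_image[OF Vector_Spaces.linear.axioms(3)[OF linear_eval]] assms by blast

text \<open>Peels off the first vector of the flag: \<open>proj e f \<circ> u \<circ> proj e f\<close> is the map induced by \<open>u\<close> on
  \<open>e\<^sup>\<bottom>/F e\<close>, identified with the complement \<open>perp H {e, f}\<close> of the hyperbolic plane of \<open>e\<close> and \<open>f\<close>.\<close>

inductive triangular_model :: "'v set \<Rightarrow> ('v \<Rightarrow> 'v) set \<Rightarrow> bool" where
  zero: "triangular_model {0} {0}"
| step: "nondeg H \<Longrightarrow> e \<in> H \<Longrightarrow> f \<in> H \<Longrightarrow> s e f = 1 \<Longrightarrow> triangular_model (perp H {e, f}) S' \<Longrightarrow>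
    triangular_model H {u \<in> A. range u \<subseteq> H \<and> u e = 0 \<and> proj e f \<circ> u \<circ> proj e f \<in> S'}"

text \<open>The property of the induced spaces that the extremal argument uses: for a generic
  \<open>a\<close> in \<open>T\<close>, the part of \<open>T\<close> orthogonal to \<open>a\<close>
  is contained in F a + S a.\<close>

definition regular_generators :: "'v set \<Rightarrow> ('v \<Rightarrow> 'v) set \<Rightarrow> bool" where
  "regular_generators H S \<longleftrightarrow> (\<forall>T. subspace T \<longrightarrow> T \<subseteq> H \<longrightarrow> T \<noteq> {0} \<longrightarrow>
     (\<exists>N. subspace N \<and> N \<subset> T \<and>
       (\<forall>a\<in>T - N. \<forall>t\<in>T. s a t = 0 \<longrightarrow> (\<exists>c. \<exists>u\<in>S. t = c *s a + u a))))"

lemma nondeg_dual: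
  assumes "nondeg H" "x \<in> H" "x \<noteq> 0"
  obtains f where "f \<in> H" "s x f = 1"
proof -
  obtain g where g: "g \<in> H" "s x g \<noteq> 0" using assms unfolding nondeg_def by blast
  have "inverse (s x g) *s g \<in> H" using g assms subspace_scale nondeg_def by auto
  moreover have "s x (inverse (s x g) *s g) = 1" using g by simp
  ultimately show ?thesis using that by blast
qed

lemma model_range: "triangular_model H S \<Longrightarrow> u \<in> S \<Longrightarrow> u \<in> A \<and> range u \<subseteq> H"
  by (induction rule: triangular_model.induct)
    (auto simp: alternating_endos_def Vector_Spaces.linear_iff vector_space_axioms)

lemma model_zero: "triangular_model H S \<Longrightarrow> nondeg H \<and> (\<lambda>z. 0) \<in> S"
proof (induction rule: triangular_model.induct)
  case zero then show ?case by (auto simp: nondeg_def zero_fun_def)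
next
  case (step H e f S')
  then show ?case
    by (auto simp: nondeg_def alternating_endos_def Vector_Spaces.linear_iff vector_space_axioms
        comp_def subspace_0)
qed

text \<open>The model contains \<open>wedge e h\<close> for every \<open>h\<close> in
  \<open>H\<close> orthogonal to \<open>e\<close>. If \<open>T\<close> is not orthogonal to
  \<open>e\<close>, these maps suffice for every \<open>a\<close> not orthogonal to
  \<open>e\<close>. Otherwise the projection of \<open>T\<close> is handled by induction, up to a
  multiple of \<open>e\<close>; if it is 0, then \<open>T\<close> is the line of
  \<open>e\<close>.\<close>

lemma model_regular_generators: "triangular_model H S \<Longrightarrow> regular_generators H S"
proof (induction rule: triangular_model.induct)
  case zero
  then show ?case unfolding regular_generators_def by (metis subset_singletonD subspace_0 empty_iff)
next
  case (step H e f S')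
  let ?S = "{u \<in> A. range u \<subseteq> H \<and> u e = 0 \<and> proj e f \<circ> u \<circ> proj e f \<in> S'}" and ?H = "perp H {e, f}"
  note xf = \<open>s e f = 1\<close>
  have sH: "subspace H" using step nondeg_def by simp
  have z: "(\<lambda>z. 0) \<in> S'" and ndH': "nondeg ?H" using model_zero[OF step(5)] by auto
  have wproj: "proj e f (wedge e h (proj e f z)) = 0" for h z
    using proj_simps(1)[OF xf] s_proj(1)[OF xf] by (simp add: wedge_def proj_diff)
  have wS: "wedge e h \<in> ?S" if "h \<in> H" "s e h = 0" for h
  proof -
    have "proj e f \<circ> wedge e h \<circ> proj e f = (\<lambda>z. 0)"
      using wproj by (simp add: fun_eq_iff)
    moreover have "range (wedge e h) \<subseteq> H"
      using sH that step(2) by (auto simp: wedge_def intro!: subspace_diff subspace_scale)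
    ultimately show ?thesis using z wedge_alternating s_eq_0_swap[of h e] that by (auto simp: wedge_def)
  qed
  show ?case unfolding regular_generators_def
  proof (intro allI impI)
    fix T assume T: "subspace T" "T \<subseteq> H" "T \<noteq> {0}"
    show "\<exists>N. subspace N \<and> N \<subset> T \<and> (\<forall>a\<in>T - N. \<forall>t\<in>T. s a t = 0 \<longrightarrow> (\<exists>c. \<exists>u\<in>?S. t = c *s a + u a))"
    proof (cases "\<forall>t\<in>T. s e t = 0")
      case False
      let ?N = "perp T {e}"
      have "\<exists>c. \<exists>u\<in>?S. t = c *s a + u a" if a: "a \<in> T - ?N" "t \<in> T" "s a t = 0" for a t
      proof -
        have ea: "s e a \<noteq> 0" using a by (auto simp: perp_def)
        define c where "c = s e t / s e a"
        \<comment> \<open>The choice of \<open>c\<close> makes \<open>h\<close> orthogonal to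
          \<open>e\<close>, and \<open>h\<close> is orthogonal to \<open>a\<close>; so
          \<open>wedge e h\<close> sends \<open>a\<close> to \<open>t - c *s a\<close>.\<close>
        define h where "h = inverse (s e a) *s (t - c *s a)"
        have tH: "a \<in> H" "t \<in> H" using a T by auto
        have "h \<in> H" unfolding h_def using tH sH by (auto intro!: subspace_diff subspace_scale)
        moreover have "s e h = 0" using ea by (simp add: h_def c_def)
        ultimately have "wedge e h \<in> ?S" by (rule wS)
        moreover have "s h a = 0" using a(3) s_eq_0_swap[of a t] by (simp add: h_def)
        then have "t = c *s a + wedge e h a" using ea by (simp add: wedge_def h_def)
        ultimately show ?thesis by blast
      qed
      moreover have "?N \<subset> T" using False by (auto simp: perp_def)
      ultimately show ?thesis using subspace_perp[OF T(1)] by blast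
    next
      case True
      let ?T = "proj e f ` T"
      have lin: "Vector_Spaces.linear scale scale (proj e f)"
        by (simp add: Vector_Spaces.linear_iff vector_space_axioms)
      note hom = Vector_Spaces.linear.axioms(3)[OF lin]
      have sT: "subspace ?T" using module_hom.subspace_image[OF hom] T(1) by blast
      have TH: "?T \<subseteq> ?H" using proj_in_perp[OF xf sH step(2,3)] T(2) by auto
      show ?thesis
      proof (cases "?T = {0}")
        case zT: True
        have "\<exists>c. t = c *s e" if "t \<in> T" for t
        proof -
          have "proj e f t = 0" using zT that by blast
          then show ?thesis using proj_eq[of t e f] True that by (intro exI[of _ "- s f t"]) simp
        qed
        then have line: "\<exists>c. t = c *s a" if at: "a \<in> T - {0}" "t \<in> T" for a t
        proof -
          obtain c where "t = c *s e" using at(2) \<open>\<And>t. t \<in> T \<Longrightarrow> \<exists>c. t = c *s e\<close> by blast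
          moreover obtain d where "a = d *s e" using at(1) \<open>\<And>t. t \<in> T \<Longrightarrow> \<exists>c. t = c *s e\<close> by blast
          ultimately have "t = (c / d) *s a" using at by auto
          then show ?thesis by blast
        qed
        have z0: "(\<lambda>z. 0) \<in> ?S" using wS[of 0] sH subspace_0 by (auto simp: wedge_def)
        moreover have "{0} \<subset> T" using T subspace_0 by blast
        moreover have "\<exists>c. \<exists>u\<in>?S. t = c *s a + u a" if "a \<in> T - {0}" "t \<in> T" for a t
          using line[OF that] z0 by (metis (no_types, lifting) add.right_neutral)
        ultimately show ?thesis using subspace_single_0 by (intro exI[of _ "{0}"] conjI) blast+
      next
        case False
        then obtain N where N: "subspace N" "N \<subset> ?T"
          "\<And>a t. a \<in> ?T - N \<Longrightarrow> t \<in> ?T \<Longrightarrow> s a t = 0 \<Longrightarrow> \<exists>c. \<exists>u\<in>S'. t = c *s a + u a"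
          using step.IH sT TH unfolding regular_generators_def by metis
        let ?N = "{t \<in> T. proj e f t \<in> N}"
        have "subspace ?N" using T(1) N(1) by (auto simp: subspace_def)
        moreover have "?N \<subset> T" using N(2) by auto
        moreover have "\<exists>c. \<exists>u\<in>?S. t = c *s a + u a" if a: "a \<in> T - ?N" "t \<in> T" "s a t = 0" for a t
        proof -
          let ?a = "proj e f a" and ?t = "proj e f t"
          have sa: "s e a = 0" "s e t = 0" using a True by auto
          have "s ?a ?t = s a ?t" by (simp add: proj_adjoint proj_simps(3)[OF xf])
          also have "\<dots> = 0" using a sa s_eq_0_swap[of a e] by (simp add: proj_def)
          finally obtain c u where u: "u \<in> S'" "?t = c *s ?a + u ?a"
            using N(3)[of ?a ?t] a by blast
          note uA = model_range[OF step(5) u(1)]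
          note ul = alternating_endosD[OF conjunct1[OF uA]]
          have uH: "u y \<in> ?H" for y using uA by auto
          \<comment> \<open>The range of \<open>u\<close> is orthogonal to \<open>e\<close> and
            \<open>f\<close>; self-adjointness turns this into the vanishing of \<open>u\<close> at
            both.\<close>
          have ue: "u e = 0" "u f = 0"
          proof -
            show "u e = 0"
            proof (rule nondegenerate')
              fix y show "s y (u e) = 0" using uH[of y] s_eq_0_swap[of _ e] ul(3)[of y e] by (simp add: perp_def)
            qed
            show "u f = 0"
            proof (rule nondegenerate')
              fix y show "s y (u f) = 0" using uH[of y] s_eq_0_swap[of _ f] ul(3)[of y f] by (simp add: perp_def)
            qed
          qed
          have up: "u (proj e f y) = u y" for y by (simp add: proj_def ul ue)
          have pu: "proj e f (u y) = u y" for y using uH[of y] by (simp add: perp_def proj_def)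
          have "?a \<noteq> 0" using a N(1) subspace_0 by auto
          then obtain g where g: "g \<in> ?H" "s ?a g = 1"
            using nondeg_dual[OF ndH', of ?a] TH a by auto
          define r where "r = t - c *s a - u a"
          \<comment> \<open>The error \<open>r\<close> is a multiple of \<open>e\<close>. As
            \<open>s g a = - 1\<close>, the added rank-two map sends \<open>a\<close> exactly to
            \<open>r\<close>, and it induces 0 on the complement.\<close>
          define w where "w = u + wedge e (- s f r *s g)"
          have "u a \<in> ?H" "u a = u ?a" using uH up by auto
          then have "proj e f r = ?t - c *s ?a - u ?a" "s e r = 0"
            using sa pu[of a] by (simp_all add: r_def proj_diff perp_def)
          then have r: "r = - s f r *s e" using u(2) proj_eq[of r e f] by simp
          have "s g a = s g ?a" using g(1) 
            using s_eq_0_swap[of g e] s_eq_0_swap[of g f] by (simp add: perp_def proj_def)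
          then have ga: "s g a = - 1" using g(2) s_swap[of g ?a] by simp
          have "t = c *s a + w a"
            using r sa ga by (simp add: w_def wedge_def r_def algebra_simps)
          moreover have "proj e f \<circ> w \<circ> proj e f = u"
            using up pu wproj by (simp add: w_def fun_eq_iff)
          moreover have "w \<in> A" using uA wedge_alternating alternating_closed by (simp add: w_def)
          moreover have "range w \<subseteq> H" using uH wS[of "- s f r *s g"] g(1) sH
            by (auto simp: w_def perp_def wedge_def step(2) intro!: subspace_add subspace_diff subspace_scale)
          moreover have "w e = 0" using ue g(1) s_eq_0_swap[of g e] by (simp add: w_def wedge_def perp_def)
          ultimately show ?thesis using u(1) by auto
        qed
        ultimately show ?thesis by blast
      qed
    qed
  qed
qed

end

section \<open>The dimension bound\<close>

locale nilpotent_alternating = fd_symplectic scale s Basis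
  for scale :: "'f::field \<Rightarrow> 'v::ab_group_add \<Rightarrow> 'v" (infixr \<open>*s\<close> 75) and s Basis +
  fixes H :: "'v set" and S :: "('v \<Rightarrow> 'v) set" and m :: nat
  assumes nondeg_H: "nondeg H" and dim_H: "dim H = 2 * m"
    and subspace_S: "E.subspace S" and S_alternating: "u \<in> S \<Longrightarrow> u \<in> A"
    and S_range: "u \<in> S \<Longrightarrow> u z \<in> H" and S_nilpotent: "u \<in> S \<Longrightarrow> nilpotent_endo u"
begin

lemma subspace_H: "subspace H"
  using nondeg_H nondeg_def by simp

lemmas S_simps = alternating_endosD(2-)[OF S_alternating]

lemma S_add: "u \<in> S \<Longrightarrow> v \<in> S \<Longrightarrow> u + v \<in> S"
  and S_scale: "u \<in> S \<Longrightarrow> fun_scale scale c u \<in> S"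
  and S_zero: "0 \<in> S"
  using E.subspace_add[OF subspace_S] E.subspace_scale[OF subspace_S] E.subspace_0[OF subspace_S] by auto

definition T :: "'v \<Rightarrow> 'v set" where
  "T x = {c *s x + u x |c u. u \<in> S}"

definition L :: "'v \<Rightarrow> 'v set" where
  "L x = {y \<in> H. s x y = 0 \<and> wedge x y \<in> S}"

lemma T_eq_span: "T x = span (insert x ((\<lambda>u. u x) ` S))"
proof -
  have sub: "subspace ((\<lambda>u. u x) ` S)" by (rule linear_image_subspace[OF subspace_S])
  then have sp: "span ((\<lambda>u. u x) ` S) = (\<lambda>u. u x) ` S" by simp
  have "y \<in> span (insert x ((\<lambda>u. u x) ` S)) \<longleftrightarrow> (\<exists>c. y - c *s x \<in> (\<lambda>u. u x) ` S)" for y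
    by (simp add: span_breakdown_eq sp)
  moreover have "(\<exists>c. y - c *s x \<in> (\<lambda>u. u x) ` S) \<longleftrightarrow> y \<in> T x" for y
    by (auto simp: T_def image_iff algebra_simps)
  ultimately show ?thesis by blast
qed

lemma subspace_T: "subspace (T x)"
  by (simp add: T_eq_span)

lemma T_subset: "x \<in> H \<Longrightarrow> T x \<subseteq> H"
  using subspace_add[OF subspace_H] subspace_scale[OF subspace_H] S_range by (auto simp: T_def)

lemma x_in_T: "x \<in> T x" and image_in_T: "u \<in> S \<Longrightarrow> u x \<in> T x"
  unfolding T_eq_span by (auto intro: span_base)

lemma image_neq:
  assumes "u \<in> S" "x \<noteq> 0" shows "u x \<noteq> x"
proof
  assume "u x = x"
  then have "(u ^^ k) x = x" for k by (induction k) auto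
  then show False using S_nilpotent[OF assms(1)] assms(2) unfolding nilpotent_endo_def by metis
qed

text \<open>The vector \<open>x\<close> is not in S x, because a nilpotent map fixes no nonzero
  vector.\<close>

lemma dim_T: "x \<noteq> 0 \<Longrightarrow> dim (T x) = Suc (dim ((\<lambda>u. u x) ` S))"
proof -
  assume "x \<noteq> 0"
  then have "x \<notin> span ((\<lambda>u. u x) ` S)"

    unfolding span_eq_iff[THEN iffD2, OF linear_image_subspace[OF subspace_S, of x]]
    using image_neq by (auto simp: image_iff) metis
  then show ?thesis by (simp add: T_eq_span dim_insert)
qed

lemma subspace_L: "subspace (L x)"
proof -
  have "L x = perp H {x} \<inter> {y. wedge x y \<in> S}" by (auto simp: L_def perp_def)
  then show ?thesis
    using subspace_inter[OF subspace_perp[OF subspace_H, of "{x}"] subspace_wedge[OF subspace_S, of x]] by simp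
qed

lemma L_orthogonal_orbit:
  assumes "y \<in> L x" "u \<in> S"
  shows "s y ((u ^^ k) x) = 0"
  using wedge_orthogonal_orbit[OF S_alternating[OF assms(2)] S_nilpotent[OF assms(2)], of x y k]
    S_nilpotent[OF S_add[OF assms(2), of "wedge x y"]] assms(1) by (simp add: L_def)

lemma L_subset_perp_T: "L x \<subseteq> perp H (T x)"
proof
  fix y assume y: "y \<in> L x"
  have "s y (u x) = 0" if "u \<in> S" for u using L_orthogonal_orbit[OF y that, of 1] by simp
  moreover have "s y x = 0" using y s_eq_0_swap by (auto simp: L_def)
  ultimately have "s y t = 0" if "t \<in> T x" for t using that by (auto simp: T_def)
  then show "y \<in> perp H (T x)" using y s_eq_0_swap by (auto simp: L_def perp_def)
qed

lemma dim_T_L: "x \<in> H \<Longrightarrow> dim (T x) + dim (L x) \<le> 2 * m"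
  using dim_perp[OF nondeg_H subspace_T T_subset, of x] dim_subset[OF L_subset_perp_T, of x] dim_H by simp

section \<open>Passing to the quotient by an isotropic line\<close>

context
  fixes x f assumes x: "x \<in> H" and f: "f \<in> H" and xf: "s x f = 1"
begin

abbreviation "quotient_S \<equiv> (\<lambda>u. proj x f \<circ> u \<circ> proj x f) ` {u \<in> S. u x = 0}"

lemma subspace_stabilizer: "E.subspace {u \<in> S. u x = 0}"
  using subspace_S by (auto simp: E.subspace_def fun_scale_def)

text \<open>Sets up the induction on \<open>m\<close>: the complement of the hyperbolic plane models
  the orthogonal of \<open>x\<close> modulo its line. The claim \<open>0 < m\<close> ensures that
  \<open>m - 1\<close> does not truncate.\<close>

lemma nilpotent_alternating_quotient:
  "nilpotent_alternating scale s Basis (perp H {x, f}) quotient_S (m - 1)" "0 < m"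
proof -
  have d: "dim H = dim (perp H {x, f}) + 2" and n: "nondeg (perp H {x, f})"
    using nondeg_perp_pair[OF xf nondeg_H x f] by auto
  show "0 < m" using d dim_H by simp
  have "E.subspace quotient_S"
    using module_hom.subspace_image[OF Vector_Spaces.linear.axioms(3)[OF linear_proj_conj] subspace_stabilizer] .
  moreover have "proj x f (u (proj x f z)) \<in> perp H {x, f}" if "u \<in> S" for u z
    using proj_in_perp[OF xf subspace_H x f] S_range[OF that] by blast
  ultimately show "nilpotent_alternating scale s Basis (perp H {x, f}) quotient_S (m - 1)"
    using n d dim_H proj_conj_alternating[OF xf S_alternating]
      proj_conj_nilpotent[OF xf S_alternating S_nilpotent]
    by unfold_locales auto
qed

text \<open>Adding a multiple of \<open>x\<close> to \<open>y\<close> does not change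
  \<open>wedge x y\<close>. So \<open>L x\<close> contains \<open>x\<close>, and modulo
  \<open>x\<close> its elements are represented in the complement.\<close>

lemma dim_L: "dim (L x) = Suc (dim {h \<in> perp H {x, f}. wedge x h \<in> S})"
proof -
  let ?L = "{h \<in> perp H {x, f}. wedge x h \<in> S}"
  have sub: "subspace ?L"
    using subspace_inter[OF subspace_perp[OF subspace_H, of "{x,f}"] subspace_wedge[OF subspace_S, of x]]
    by (simp add: Int_def)
  have "L x = span (insert x ?L)"
  proof
    show "L x \<subseteq> span (insert x ?L)"
    proof
      fix y assume y: "y \<in> L x"
      have py: "proj x f y = y - (- s f y) *s x" using y by (simp add: proj_def L_def)
      then have "wedge x (proj x f y) = wedge x y" by (simp add: wedge_add wedge_scale fun_scale_def zero_fun_def)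
      then have "y - (- s f y) *s x \<in> ?L"
        using y proj_in_perp[OF xf subspace_H x f, of y] py by (simp add: L_def)
      then have "y - (- s f y) *s x \<in> span ?L" by (rule span_base)
      then show "y \<in> span (insert x ?L)" unfolding span_breakdown_eq by (rule exI)
    qed
    have "x \<in> L x" using x S_zero by (simp add: L_def)
    moreover have "?L \<subseteq> L x" by (auto simp: L_def perp_def)
    ultimately show "span (insert x ?L) \<subseteq> L x" by (intro span_minimal subspace_L) auto
  qed
  moreover have "x \<notin> span ?L" 
    unfolding span_eq_iff[THEN iffD2, OF sub] using s_fx[OF xf] by (simp add: perp_def)
  ultimately show ?thesis by (simp add: dim_insert)
qed

text \<open>By \<open>alternating_decomposition\<close> an element inducing 0 equals
  \<open>wedge x (u f)\<close>, so evaluation at \<open>f\<close> identifies this kernel with the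
  space of the vectors \<open>h\<close>.\<close>

lemma has_dim_stabilizer_kernel:
  "has_dim (fun_scale scale) {u \<in> {u \<in> S. u x = 0}. proj x f \<circ> u \<circ> proj x f = 0}
     (dim {h \<in> perp H {x, f}. wedge x h \<in> S})" (is "has_dim _ ?K (dim ?L)")
proof -
  have K: "u = wedge x (u f)" "u f \<in> ?L" if "u \<in> ?K" for u
  proof -
    have u: "u \<in> S" "u x = 0" "\<And>z. proj x f (u (proj x f z)) = 0"
      using that by (auto simp: fun_eq_iff)
    show eq: "u = wedge x (u f)"
    proof
      fix z show "u z = wedge x (u f) z"
        using alternating_decomposition[OF xf S_alternating[OF u(1)] u(2), of z] unfolding u(3) by simp
    qed
    have "s x (u f) = 0" using S_simps(2)[OF u(1), of x f] u(2) by simp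
    then show "u f \<in> ?L" using eq u(1) S_range S_simps(1)[OF u(1), of f] by (simp add: perp_def)
  qed
  have img: "(\<lambda>u. u f) ` ?K = ?L"
  proof
    show "(\<lambda>u. u f) ` ?K \<subseteq> ?L" using K by blast
    show "?L \<subseteq> (\<lambda>u. u f) ` ?K"
    proof
      fix h assume h: "h \<in> ?L"
      have 0: "s h f = 0" "s h x = 0" using h s_eq_0_swap by (auto simp: perp_def)
      then have "wedge x h f = h" "wedge x h x = 0" by (simp_all add: wedge_def xf)
      moreover have "proj x f (wedge x h (proj x f z)) = 0" for z
        using s_proj(1)[OF xf] proj_simps(1)[OF xf] by (simp add: wedge_def)
      ultimately have "wedge x h \<in> ?K" "h = wedge x h f" using h by (auto simp: fun_eq_iff)
      then show "h \<in> (\<lambda>u. u f) ` ?K" by blast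
    qed
  qed
  have sub: "E.subspace ?K"
    using subspace_S by (auto simp: E.subspace_def fun_scale_def fun_eq_iff)
  have "u = 0" if "u \<in> ?K" "u f = 0" for u
    using K(1)[OF that(1)] that(2) by (simp add: wedge_def fun_eq_iff)
  moreover have "0 \<in> ?K" "(0 :: 'v \<Rightarrow> 'v) f = 0" using E.subspace_0[OF sub] by simp_all
  ultimately have ker: "{u \<in> ?K. u f = 0} = {0}" by blast
  have "subspace ?L" using linear_image_subspace[OF sub, of f] img by simp
  then show ?thesis
    using EV.has_dim_kernel_image[OF linear_eval[of f] sub, of 0 "dim ?L"] E.has_dim_zero ker img has_dim_dim
    by simp
qed

text \<open>Two uses of rank-nullity: evaluation at \<open>x\<close> has image of dimension
  \<open>dim (T x) - 1\<close>, and passing to induced maps has kernel of dimension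
  \<open>dim (L x) - 1\<close>. The summand 2 accounts for both ones without subtraction.\<close>

lemma has_dim_quotient:
  assumes "has_dim (fun_scale scale) quotient_S k"
  shows "\<exists>j. has_dim (fun_scale scale) S j \<and> j + 2 = k + dim (T x) + dim (L x)"
proof -
  have "has_dim (fun_scale scale) {u \<in> S. u x = 0} (dim {h \<in> perp H {x, f}. wedge x h \<in> S} + k)"
    by (rule EE.has_dim_kernel_image[OF linear_proj_conj subspace_stabilizer has_dim_stabilizer_kernel assms])
  then have "has_dim (fun_scale scale) S (dim {h \<in> perp H {x, f}. wedge x h \<in> S} + k + dim ((\<lambda>u. u x) ` S))"
    by (rule EV.has_dim_kernel_image[OF linear_eval subspace_S])
      (rule has_dim_dim, rule linear_image_subspace[OF subspace_S])
  moreover have "x \<noteq> 0" using xf by auto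
  ultimately show ?thesis using dim_L dim_T[of x]
    by (intro exI[of _ "dim {h \<in> perp H {x, f}. wedge x h \<in> S} + k + dim ((\<lambda>u. u x) ` S)"]) simp
qed

end

end

context fd_symplectic
begin

theorem nilpotent_alternating_bound:
  assumes "nilpotent_alternating scale s Basis H S m"
  shows "\<exists>k. has_dim (fun_scale scale) S k \<and> k \<le> m * (m - 1)"
  using assms
proof (induction m arbitrary: H S)
  case 0
  interpret nilpotent_alternating scale s Basis H S 0 by (rule 0)
  have "H = {0}" using dim_H subspace_H subspace_0 by (auto simp: dim_eq_0)
  then have "u = 0" if "u \<in> S" for u using S_range[OF that] by (auto simp: fun_eq_iff)
  then have "S = {0}" using S_zero by auto
  then show ?case using E.has_dim_zero by auto
next
  case (Suc m)
  interpret nilpotent_alternating scale s Basis H S "Suc m" by (rule Suc.prems)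
  have "\<not> H \<subseteq> {0}" using dim_H dim_eq_0[of H] by auto
  then obtain x where x: "x \<in> H" "x \<noteq> 0" by auto
  then obtain f where f: "f \<in> H" "s x f = 1" using nondeg_dual[OF nondeg_H] by metis
  obtain k where k: "has_dim (fun_scale scale) ((\<lambda>u. proj x f \<circ> u \<circ> proj x f) ` {u \<in> S. u x = 0}) k"
      "k \<le> m * (m - 1)"
    using Suc.IH nilpotent_alternating_quotient(1)[OF x(1) f] by auto
  obtain j where j: "has_dim (fun_scale scale) S j" "j + 2 = k + dim (T x) + dim (L x)"
    using has_dim_quotient[OF x(1) f k(1)] by blast
  \<comment> \<open>The induced space contributes at most \<open>m * (m - 1)\<close>, and
    orthogonality of \<open>T x\<close> and \<open>L x\<close> bounds their dimensions together by
    \<open>2 * Suc m\<close>.\<close>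
  have "j + 2 \<le> m * (m - 1) + 2 * Suc m" using j(2) k(2) dim_T_L[OF x(1)] by linarith
  then have "j \<le> Suc m * (Suc m - 1)" by (cases m) (auto simp: algebra_simps)
  then show ?case using j(1) by blast
qed

end

section \<open>Equality in the dimension bound\<close>

context nilpotent_alternating
begin

text \<open>Equality in the bound forces equality in both estimates behind it: the induced space is
  again extremal, and the dimensions of \<open>T x\<close> and \<open>L x\<close> add up to
  \<open>2 * m\<close>.\<close>

lemma extremal:
  assumes ext: "has_dim (fun_scale scale) S (m * (m - 1))" and x: "x \<in> H" and f: "f \<in> H" "s x f = 1"
  shows "L x = perp H (T x)" "T x = perp H (L x)"
    "has_dim (fun_scale scale) ((\<lambda>u. proj x f \<circ> u \<circ> proj x f) ` {u \<in> S. u x = 0}) ((m - 1) * (m - 1 - 1))"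
proof -
  obtain k where k: "has_dim (fun_scale scale) ((\<lambda>u. proj x f \<circ> u \<circ> proj x f) ` {u \<in> S. u x = 0}) k"
      "k \<le> (m - 1) * (m - 1 - 1)"
    using nilpotent_alternating_bound[OF nilpotent_alternating_quotient(1)[OF x f]] by blast
  have m: "0 < m" by (rule nilpotent_alternating_quotient(2)[OF x f])
  obtain j where j: "has_dim (fun_scale scale) S j" "j + 2 = k + dim (T x) + dim (L x)"
    using has_dim_quotient[OF x f k(1)] by blast
  have "j = m * (m - 1)" using E.has_dim_imp_dim[OF j(1)] E.has_dim_imp_dim[OF ext] by simp
  moreover have "m * (m - 1) + 2 = (m - 1) * (m - 1 - 1) + 2 * m"
  proof (cases m)
    case (Suc m') then show ?thesis by (cases m') (auto simp: algebra_simps)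
  qed (use m in simp)
  ultimately have eq: "k = (m - 1) * (m - 1 - 1)" "dim (T x) + dim (L x) = 2 * m"
    using j(2) k(2) dim_T_L[OF x] by linarith+
  have "dim (perp H (T x)) \<le> dim (L x)"
    using dim_perp[OF nondeg_H subspace_T T_subset[OF x]] eq(2) dim_H by linarith
  then show 1: "L x = perp H (T x)"
    using subspace_dim_equal[OF subspace_L subspace_perp[OF subspace_H] L_subset_perp_T] by blast
  show "T x = perp H (L x)" using perp_perp[OF nondeg_H subspace_T T_subset[OF x]] 1 by simp
  show "has_dim (fun_scale scale) ((\<lambda>u. proj x f \<circ> u \<circ> proj x f) ` {u \<in> S. u x = 0}) ((m - 1) * (m - 1 - 1))"
    using k(1) eq(1) by simp
qed

end

section \<open>A common kernel in the extremal case\<close>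

lemma ex_avoiding_two:
  assumes "infinite (UNIV :: 'f set) \<or> 2 < card (UNIV :: 'f set)"
  shows "\<exists>c::'f. c \<noteq> a \<and> c \<noteq> b"
proof (rule ccontr)
  assume "\<not> ?thesis"
  then have eq: "(UNIV :: 'f set) = {a, b}" by auto
  have "finite {a, b}" "card {a, b} \<le> 2" by (auto simp: card_insert_if)
  then show False using assms unfolding eq by auto
qed

text \<open>Take \<open>p\<close> outside \<open>A\<close> and \<open>B\<close>. If \<open>p\<close>
  lies in \<open>C\<close> and \<open>q\<close> does not, the line of the \<open>q + c p\<close>
  avoids \<open>C\<close> and meets \<open>A\<close> and \<open>B\<close> at most once each, so a
  third scalar works.\<close>

lemma (in vector_space) three_proper_subspaces_no_cover:
  assumes F: "infinite (UNIV :: 'a set) \<or> 2 < card (UNIV :: 'a set)"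
    and S: "subspace S" and A: "subspace A" "\<not> S \<subseteq> A" and B: "subspace B" "\<not> S \<subseteq> B"
    and C: "subspace C" "\<not> S \<subseteq> C"
  shows "\<exists>v\<in>S. v \<notin> A \<and> v \<notin> B \<and> v \<notin> C"
proof -
  have uniq: "c = d" if "subspace X" "p \<notin> X" "q + scale c p \<in> X" "q + scale d p \<in> X" for X p q c d
  proof (rule ccontr)
    assume "c \<noteq> d"
    have "(q + scale c p) - (q + scale d p) \<in> X" using that subspace_diff by blast
    then have "scale (c - d) p \<in> X" by (simp add: scale_left_diff_distrib)
    then have "scale (inverse (c - d)) (scale (c - d) p) \<in> X" using that(1) subspace_scale by blast
    then show False using that(2) \<open>c \<noteq> d\<close> by simp
  qed
  have stay: "q + scale c p \<notin> X" if "subspace X" "p \<in> X" "q \<notin> X" for X p q c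
  proof
    assume "q + scale c p \<in> X"
    then have "(q + scale c p) - scale c p \<in> X" using that subspace_diff subspace_scale by blast
    then show False using that(3) by simp
  qed
  have "\<exists>p\<in>S. p \<notin> A \<and> p \<notin> B"
  proof (rule ccontr)
    assume no: "\<not> (\<exists>p\<in>S. p \<notin> A \<and> p \<notin> B)"
    obtain p q where p: "p \<in> S" "p \<notin> A" and q: "q \<in> S" "q \<notin> B" using A B by blast
    have "p \<in> B" using no p by blast
    have "q + scale c p \<in> S" for c using S p q subspace_add subspace_scale by blast
    then have A: "q + scale c p \<in> A" for c using stay[OF B(1) \<open>p \<in> B\<close> q(2)] no by blast
    then show False using uniq[OF assms(3) p(2) A[of 0] A[of 1]] by simp
  qed
  then obtain p where p: "p \<in> S" "p \<notin> A" "p \<notin> B" by blast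
  obtain q where q: "q \<in> S" "q \<notin> C" using C by blast
  show ?thesis
  proof (cases "p \<in> C")
    case True
    obtain a where a: "\<And>c. q + scale c p \<in> A \<Longrightarrow> c = a" using uniq[OF A(1) p(2)] by metis
    obtain b where b: "\<And>c. q + scale c p \<in> B \<Longrightarrow> c = b" using uniq[OF B(1) p(3)] by metis
    obtain c where "c \<noteq> a" "c \<noteq> b" using ex_avoiding_two[OF F] by blast
    then have "q + scale c p \<notin> A" "q + scale c p \<notin> B" using a b by blast+
    moreover have "q + scale c p \<in> S" using S p q subspace_add subspace_scale by blast
    ultimately show ?thesis using stay[OF C(1) True q(2)] by blast
  qed (use p in blast)
qed

section \<open>Nilpotency indices\<close>

context nilpotent_alternating
begin

lemma funpow_in_H: "u \<in> S \<Longrightarrow> z \<in> H \<Longrightarrow> (u ^^ k) z \<in> H"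
  by (induction k) (auto simp: S_range)

text \<open>If \<open>l\<close> is the exact nilpotency index at \<open>z\<close>, then
  \<open>u ^^ (l - 1)\<close> kills all later orbit vectors but not \<open>z\<close>, so
  \<open>z\<close> lies outside their span.\<close>

lemma dim_span_orbit:
  assumes u: "u \<in> S" and "(u ^^ k) z \<noteq> 0"
  shows "dim (span ((\<lambda>i. (u ^^ i) z) ` {..k})) = Suc k"
  using assms(2)
proof (induction k arbitrary: z)
  case 0 then show ?case by simp
next
  case (Suc k)
  note A = S_alternating[OF u]
  obtain K where K: "\<And>j x. K \<le> j \<Longrightarrow> (u ^^ j) x = 0"
    using nilpotent_eventually[OF A S_nilpotent[OF u]] by metis
  have nz: "(u ^^ 0) z \<noteq> 0" using Suc.prems funpow_alternating(1)[OF A, of "Suc k"] by (intro notI) simp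
  define l where "l = (LEAST j. (u ^^ j) z = 0)"
  have l0: "(u ^^ l) z = 0" unfolding l_def by (rule LeastI[of _ K]) (simp add: K)
  have "l \<noteq> 0" using l0 nz by (metis)
  then obtain j where j: "l = Suc j" using not0_implies_Suc by blast
  have lz: "(u ^^ j) z \<noteq> 0" using not_less_Least[of j "\<lambda>j. (u ^^ j) z = 0"] j l_def by simp
  have sub: "subspace {y. (u ^^ j) y = 0}"
  proof -
    have "(u ^^ j) (x + y) = (u ^^ j) x + (u ^^ j) y" "(u ^^ j) (c *s x) = c *s (u ^^ j) x" for x y c
      by (induction j) (auto simp: alternating_endosD[OF A])
    then show ?thesis using funpow_alternating(1)[OF A] by (auto simp: subspace_def)
  qed
  have "(u ^^ j) ((u ^^ i) (u z)) = 0" for i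
  proof -
    have "(u ^^ j) ((u ^^ i) (u z)) = (u ^^ i) ((u ^^ Suc j) z)"
      by (metis comp_apply funpow_add add.commute funpow_swap1 funpow.simps(2))
    then show ?thesis using l0 j funpow_alternating(1)[OF A] by simp
  qed
  then have "span ((\<lambda>i. (u ^^ i) (u z)) ` {..k}) \<subseteq> {y. (u ^^ j) y = 0}"
    by (intro span_minimal sub) auto
  then have notin: "z \<notin> span ((\<lambda>i. (u ^^ i) (u z)) ` {..k})" using lz by blast
  have "(u ^^ k) (u z) \<noteq> 0" using Suc.prems by (simp add: funpow_swap1)
  then have IH: "dim ((\<lambda>i. (u ^^ i) (u z)) ` {..k}) = Suc k" using Suc.IH by simp
  have "(\<lambda>i. (u ^^ i) z) ` {..Suc k} = insert z ((\<lambda>i. (u ^^ i) (u z)) ` {..k})"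
    by (simp add: atMost_Suc_eq_insert_0 image_image funpow_swap1)
  then show ?case using notin IH by (simp add: dim_insert)
qed

text \<open>An orbit spans a totally isotropic subspace, whose dimension in \<open>H\<close> is at
  most \<open>m\<close>. This halves the obvious bound \<open>2 * m\<close>, so a field with
  \<open>m\<close> elements has enough scalars for \<open>first_order\<close>.\<close>

lemma nilpotency_index_le:
  assumes u: "u \<in> S" and z: "z \<in> H"
  shows "(u ^^ m) z = 0"
proof (rule ccontr)
  assume nz: "(u ^^ m) z \<noteq> 0"
  let ?C = "(\<lambda>i. (u ^^ i) z) ` {..m}"
  have CH: "span ?C \<subseteq> H" using funpow_in_H[OF u z] by (intro span_minimal subspace_H) auto
  have "?C \<subseteq> perp H ?C"
    using funpow_in_H[OF u z] funpow_alternating(3)[OF S_alternating[OF u]] by (auto simp: perp_def)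
  then have "span ?C \<subseteq> perp H (span ?C)"
    unfolding perp_span by (intro span_minimal subspace_perp subspace_H)
  then have "dim (span ?C) \<le> dim (perp H (span ?C))" by (rule dim_subset)
  then show False
    using dim_perp[OF nondeg_H subspace_span CH] dim_span_orbit[OF u nz] dim_H by linarith
qed

lemma maximal_nilpotency_index:
  assumes "z \<in> W" "z \<noteq> 0" "W \<subseteq> H"
  obtains q w y where "0 < q" "q \<le> m" "w \<in> S" "y \<in> W" "(w ^^ (q - 1)) y \<noteq> 0"
    "\<And>u x. u \<in> S \<Longrightarrow> x \<in> W \<Longrightarrow> (u ^^ q) x = 0"
proof -
  define P where "P k \<longleftrightarrow> (\<forall>u\<in>S. \<forall>x\<in>W. (u ^^ k) x = 0)" for k
  define q where "q = (LEAST k. P k)"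
  have Pm: "P m" unfolding P_def using nilpotency_index_le assms(3) by blast
  then have Pq: "P q" "q \<le> m" unfolding q_def by (rule LeastI, rule Least_le)
  have "\<not> P 0" using assms S_zero by (auto simp: P_def)
  then have q0: "0 < q" using Pq by (cases q) auto
  then have "\<not> P (q - 1)" using not_less_Least[of "q - 1" P] by (simp add: q_def)
  then show ?thesis using that q0 Pq unfolding P_def by blast
qed

lemma image_power_in_image:
  assumes F: "infinite (UNIV :: 'f set) \<or> m \<le> card (UNIV :: 'f set)"
    and W: "subspace W" "\<And>u z. u \<in> S \<Longrightarrow> z \<in> W \<Longrightarrow> u z \<in> W"
    and q: "0 < q" "q \<le> m" and nil: "\<And>u x. u \<in> S \<Longrightarrow> x \<in> W \<Longrightarrow> (u ^^ q) x = 0"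
    and w: "w \<in> S" "v \<in> S" "y \<in> W"
  shows "v ((w ^^ (q - 1)) y) \<in> w ` W"
proof (rule first_order[OF S_alternating[OF w(2)] S_alternating[OF w(1)] W(1)])
  show "v ` W \<subseteq> W" "w ` W \<subseteq> W" using W(2) w by auto
  show "y \<in> W" "0 < q" using w q by auto
  show "infinite (UNIV :: 'f set) \<or> q \<le> card (UNIV :: 'f set)" using F q by auto
  show "(v ^^ q) y = 0" using nil w by blast
  fix c
  have "(\<lambda>y. w y + c *s v y) = w + fun_scale scale c v" by (simp add: fun_scale_def fun_eq_iff)
  then show "((\<lambda>y. w y + c *s v y) ^^ q) y = 0"
    using nil[OF S_add[OF w(1) S_scale[OF w(2)]] w(3)] by simp
qed

end

text \<open>Collects what equality in the bound and the induction on \<open>m\<close> provide, for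
  every nonzero \<open>x\<close> and every \<open>f\<close> dual to it.\<close>

locale extremal_nilpotent = nilpotent_alternating +
  assumes L_eq: "x \<in> H \<Longrightarrow> x \<noteq> 0 \<Longrightarrow> L x = perp H (T x)"
    and T_eq: "x \<in> H \<Longrightarrow> x \<noteq> 0 \<Longrightarrow> T x = perp H (L x)"
    and regular: "x \<in> H \<Longrightarrow> f \<in> H \<Longrightarrow> s x f = 1 \<Longrightarrow>
      regular_generators (perp H {x, f}) ((\<lambda>u. proj x f \<circ> u \<circ> proj x f) ` {u \<in> S. u x = 0})"
    and field_gt_2: "infinite (UNIV :: 'a set) \<or> 2 < card (UNIV :: 'a set)"
    and field_ge: "infinite (UNIV :: 'a set) \<or> m \<le> card (UNIV :: 'a set)"
begin

section \<open>Stability of \<open>T x\<close> under generic elements\<close>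

lemma in_T_iff: "x \<in> H \<Longrightarrow> x \<noteq> 0 \<Longrightarrow> t \<in> T x \<longleftrightarrow> t \<in> H \<and> (\<forall>y\<in>L x. s y t = 0)"
  using T_eq[of x] by (auto simp: perp_def)

lemma in_L_iff: "x \<in> H \<Longrightarrow> x \<noteq> 0 \<Longrightarrow> y \<in> L x \<longleftrightarrow> y \<in> H \<and> (\<forall>t\<in>T x. s t y = 0)"
  using L_eq[of x] by (auto simp: perp_def)

lemma L_T_orthogonal: "y \<in> L x \<Longrightarrow> t \<in> T x \<Longrightarrow> s y t = 0"
  using L_subset_perp_T[of x] s_eq_0_swap[of t y] by (auto simp: perp_def)

text \<open>\<open>L x\<close> is orthogonal to whole orbits, and \<open>T x\<close> is its
  orthogonal; hence \<open>T x\<close> contains the higher powers too.\<close>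

lemma orbit_in_T:
  assumes "x \<in> H" "x \<noteq> 0" "u \<in> S"
  shows "(u ^^ k) x \<in> T x"
  unfolding in_T_iff[OF assms(1,2)] using funpow_in_H[OF assms(3,1)] L_orthogonal_orbit[OF _ assms(3)] by blast

text \<open>Polarizes squares: for \<open>u x = 0\<close>, the vector \<open>u (w x)\<close> is the
  difference of the squares of \<open>u + w\<close> and \<open>w\<close> at
  \<open>x\<close>.\<close>

lemma stabilizer_T:
  assumes x: "x \<in> H" "x \<noteq> 0" and u: "u \<in> S" "u x = 0" and t: "t \<in> T x"
  shows "u t \<in> T x"
proof -
  obtain c w where w: "w \<in> S" "t = c *s x + w x" using t by (auto simp: T_def)
  have "((u + w) ^^ 2) x = u (w x) + (w ^^ 2) x"
    using u by (simp add: numeral_2_eq_2 S_simps)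
  then have "u (w x) = ((u + w) ^^ 2) x - (w ^^ 2) x" by simp
  also have "\<dots> \<in> T x"
    by (intro subspace_diff[OF subspace_T] orbit_in_T[OF x] S_add u w)
  finally show ?thesis using w u by (simp add: S_simps)
qed

text \<open>The cubic analogue of \<open>stabilizer_T\<close>: in the cube of \<open>v + w\<close>
  at \<open>x\<close>, every other term is already known to lie in \<open>T x\<close>.\<close>

lemma conjugate_orbit_in_T:
  assumes x: "x \<in> H" "x \<noteq> 0" and w: "w \<in> S" "w x = 0" and v: "v \<in> S"
  shows "v (w (v x)) \<in> T x"
proof -
  have "((v + w) ^^ 3) x = (v ^^ 3) x + v (w (v x)) + w ((v ^^ 2) x) + w (w (v x))"
    using w v by (simp add: numeral_2_eq_2 numeral_3_eq_3 S_simps)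
  then have "v (w (v x)) = ((v + w) ^^ 3) x - (v ^^ 3) x - w ((v ^^ 2) x) - w (w (v x))" by simp
  also have "\<dots> \<in> T x"
    by (intro subspace_diff[OF subspace_T] stabilizer_T[OF x w] orbit_in_T[OF x] S_add v w image_in_T)
  finally show ?thesis .
qed

lemma eigenvector_zero:
  assumes "u \<in> S" "u x = c *s x"
  shows "u x = 0"
proof (rule ccontr)
  assume "u x \<noteq> 0"
  then have "c \<noteq> 0" "x \<noteq> 0" using assms(2) by auto
  then have "fun_scale scale (inverse c) u x = x" using assms(2) by (simp add: fun_scale_def)
  then show False using image_neq[OF S_scale[OF assms(1)] \<open>x \<noteq> 0\<close>] by blast
qed

lemma s_x_T: "t \<in> T x \<Longrightarrow> s x t = 0"
  by (auto simp: T_def S_simps(1))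

text \<open>For \<open>v\<close> outside \<open>M\<close> the projection of \<open>v x\<close> is
  generic, so regularity of the induced space gives \<open>t = c *s v x + w (v x) + d *s x\<close>
  with \<open>w x = 0\<close>. Applying \<open>v\<close> yields three terms of \<open>T x\<close>,
  the middle one by \<open>conjugate_orbit_in_T\<close>.\<close>

lemma generic_elements:
  assumes x: "x \<in> H" "x \<noteq> 0" and nz: "\<exists>u\<in>S. u x \<noteq> 0"
  obtains M where "E.subspace M" "M \<subset> S"
    "\<And>v t. v \<in> S - M \<Longrightarrow> t \<in> T x \<Longrightarrow> s t (v x) = 0 \<Longrightarrow> v t \<in> T x"
proof -
  obtain f where f: "f \<in> H" "s x f = 1" using nondeg_dual[OF nondeg_H x] by metis
  let ?p = "proj x f"
  have lin: "Vector_Spaces.linear scale scale ?p"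
    by (simp add: Vector_Spaces.linear_iff vector_space_axioms)
  have sT: "subspace (?p ` T x)"
    using module_hom.subspace_image[OF Vector_Spaces.linear.axioms(3)[OF lin] subspace_T] .
  have TH: "?p ` T x \<subseteq> perp H {x, f}" using proj_in_perp[OF f(2) subspace_H x(1) f(1)] T_subset[OF x(1)] by auto
  have nz': "?p ` T x \<noteq> {0}"
  proof
    assume 0: "?p ` T x = {0}"
    have "u x = 0" if u: "u \<in> S" for u
    proof -
      have "?p (u x) = 0" using 0 image_in_T[OF u, of x] by blast
      then have "u x = (- s f (u x)) *s x" using proj_eq[of "u x" x f] S_simps(1)[OF u, of x] by simp
      then show ?thesis by (rule eigenvector_zero[OF u])
    qed
    then show False using nz by blast
  qed
  obtain N where N: "subspace N" "N \<subset> ?p ` T x"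
    "\<And>a t. a \<in> ?p ` T x - N \<Longrightarrow> t \<in> ?p ` T x \<Longrightarrow> s a t = 0 \<Longrightarrow>
      \<exists>c. \<exists>u\<in>(\<lambda>u. ?p \<circ> u \<circ> ?p) ` {u \<in> S. u x = 0}. t = c *s a + u a"
    using regular[OF x(1) f, unfolded regular_generators_def, THEN spec, of "?p ` T x",
        THEN mp, OF sT, THEN mp, OF TH, THEN mp, OF nz'] by blast
  define M where "M = {v \<in> S. ?p (v x) \<in> N}"
  have "E.subspace M"
    using N(1) subspace_S by (auto simp: M_def E.subspace_def subspace_def fun_scale_def)
  moreover have "M \<subset> S"
  proof -
    obtain a where a: "a \<in> T x" "?p a \<notin> N" using N(2) by blast
    then obtain c v where v: "v \<in> S" "a = c *s x + v x" by (auto simp: T_def)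
    then have "?p a = ?p (v x)" using proj_simps(1)[OF f(2)] by simp
    then show ?thesis using a v by (auto simp: M_def)
  qed
  moreover have "v t \<in> T x" if v: "v \<in> S - M" and t: "t \<in> T x" "s t (v x) = 0" for v t
  proof -
    have vS: "v \<in> S" "?p (v x) \<notin> N" using v by (auto simp: M_def)
    have xt: "s x t = 0" "s x (v x) = 0" "s (v x) x = 0" "s (v x) t = 0"
      using s_x_T[OF t(1)] s_x_T[OF image_in_T[OF vS(1)]] s_eq_0_swap t(2) by blast+
    have "s (?p (v x)) (?p t) = s (v x) (?p t)" by (simp add: proj_adjoint proj_simps(3)[OF f(2)])
    also have "\<dots> = 0" using xt by (simp add: proj_def)
    finally obtain c u where u: "u \<in> (\<lambda>u. ?p \<circ> u \<circ> ?p) ` {u \<in> S. u x = 0}" "?p t = c *s ?p (v x) + u (?p (v x))"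
      using N(3)[of "?p (v x)" "?p t"] t(1) vS(2) image_in_T[OF vS(1), of x] by blast
    then obtain w where w: "w \<in> S" "w x = 0" "?p t = c *s ?p (v x) + ?p (w (?p (?p (v x))))"
      by auto
    have "w (?p y) = w y" if "s x y = 0" for y using that w by (simp add: proj_def S_simps)
    then have "?p t = c *s ?p (v x) + ?p (w (v x))" using w(3) xt proj_simps(3)[OF f(2)] by simp
    moreover define r where "r = t - c *s v x - w (v x)"
    ultimately have p0: "?p r = 0" by (simp add: proj_diff)
    have "s x (w (v x)) = 0" using S_simps(2)[OF w(1), of x "v x"] w(2) by simp
    then have "s x r = 0" using xt by (simp add: r_def)
    then have "r = (- s f r) *s x" using proj_eq[of r x f] p0 by simp
    then have "t - c *s v x - w (v x) = (- s f r) *s x" by (simp only: r_def)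
    then obtain d where "t - c *s v x - w (v x) = d *s x" by blast
    then have "t = c *s v x + w (v x) + d *s x" by (simp add: algebra_simps)
    then have "v t = c *s (v ^^ 2) x + v (w (v x)) + d *s v x"
      using vS(1) by (simp add: numeral_2_eq_2 S_simps)
    also have "\<dots> \<in> T x"
      by (intro subspace_add[OF subspace_T] subspace_scale[OF subspace_T] orbit_in_T[OF x vS(1)]
          conjugate_orbit_in_T[OF x w(1,2) vS(1)] image_in_T vS(1))
    finally show ?thesis .
  qed
  ultimately show ?thesis using that by blast
qed

text \<open>An element of \<open>M\<close> is a difference of two elements of \<open>S\<close>
  outside \<open>M\<close>.\<close>

lemma eq_on_complement:
  assumes M: "E.subspace M" "M \<subset> S" and P: "\<And>v. v \<in> S - M \<Longrightarrow> P v"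
    and diff: "\<And>v w. v \<in> S \<Longrightarrow> w \<in> S \<Longrightarrow> P (v + w) \<Longrightarrow> P w \<Longrightarrow> P v" and v: "v \<in> S"
  shows "P v"
proof (cases "v \<in> M")
  case True
  obtain w where w: "w \<in> S" "w \<notin> M" using M(2) by blast
  have "v + w \<notin> M"
  proof
    assume "v + w \<in> M"
    then have "(v + w) - v \<in> M" using True E.subspace_diff[OF M(1)] by blast
    then show False using w(2) by simp
  qed
  then show ?thesis using P w S_add[OF v w(1)] diff[OF v w(1)] by blast
qed (use P v in blast)

text \<open>A generic \<open>v\<close> maps the part of \<open>T x\<close> orthogonal to
  \<open>v x\<close> into \<open>T x\<close>, which is orthogonal to \<open>y\<close>; so
  \<open>s (v y)\<close> is a multiple of \<open>s (v x)\<close> on \<open>T x\<close>. Both forms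
  in \<open>v\<close> and \<open>v'\<close> are alternating, the first because
  \<open>s (v y) (v x) = s y (v (v x)) = 0\<close>, and this makes the factor independent of
  \<open>v\<close>.\<close>

lemma proportional_forms:
  assumes x: "x \<in> H" "x \<noteq> 0" and nz: "\<exists>u\<in>S. u x \<noteq> 0" and y: "y \<in> L x"
  shows "\<exists>k. \<forall>v\<in>S. \<forall>v'\<in>S. s (v y) (v' x) = k * s (v x) (v' x)"
proof -
  obtain M where M: "E.subspace M" "M \<subset> S"
    "\<And>v t. v \<in> S - M \<Longrightarrow> t \<in> T x \<Longrightarrow> s t (v x) = 0 \<Longrightarrow> v t \<in> T x"
    using generic_elements[OF x nz] by metis
  define b where "b v v' = s (v x) (v' x)" for v v' :: "'b \<Rightarrow> 'b"
  define c where "c v v' = s (v y) (v' x)" for v v' :: "'b \<Rightarrow> 'b"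
  have b_swap: "b v v' = - b v' v" for v v' unfolding b_def by (rule s_swap)
  have c_diag: "c v v = 0" if "v \<in> S" for v
    using L_orthogonal_orbit[OF y that, of 2] S_simps(2)[OF that, of y "v x"] by (simp add: c_def numeral_2_eq_2)
  have c_swap: "c v v' = - c v' v" if "v \<in> S" "v' \<in> S" for v v'
  proof -
    have "c (v + v') (v + v') = c v v + c v v' + (c v' v + c v' v')" by (simp add: c_def)
    then have "c v v' + c v' v = 0" using c_diag[OF S_add[OF that]] c_diag that by simp
    then show ?thesis by (simp add: eq_neg_iff_add_eq_0)
  qed
  have vanish: "s (v y) t = 0" if "v \<in> S - M" "t \<in> T x" "s (v x) t = 0" for v t
  proof -
    have "v t \<in> T x" using M(3)[OF that(1,2)] that(3) s_eq_0_swap by blast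
    then have "s y (v t) = 0" by (rule L_T_orthogonal[OF y])
    then show ?thesis using S_simps(2)[of v y t] that(1) by simp
  qed
  have ratio: "c v v' * b v v'' = c v v'' * b v v'" if "v \<in> S - M" "v' \<in> S" "v'' \<in> S" for v v' v''
  proof -
    let ?t = "b v v'' *s v' x - b v v' *s v'' x"
    have "?t \<in> T x"
      by (intro subspace_diff[OF subspace_T] subspace_scale[OF subspace_T] image_in_T that)
    moreover have "s (v x) ?t = 0" by (simp add: b_def)
    ultimately have "s (v y) ?t = 0" using vanish that(1) by blast
    then show ?thesis by (simp add: c_def mult.commute)
  qed
  have zero: "c v v' = 0" if "v \<in> S - M" "v' \<in> S" "b v v' = 0" for v v'
    using vanish[OF that(1) image_in_T[OF that(2)]] that(3) by (simp add: b_def c_def)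
  have "\<exists>k. \<forall>v\<in>S - M. \<forall>v'\<in>S. c v v' = k * b v v'"
  proof (cases "\<forall>v\<in>S - M. \<forall>v'\<in>S. b v v' = 0")
    case True
    then show ?thesis using zero by (intro exI[of _ 0]) auto
  next
    case False
    then obtain v0 v1 where v0: "v0 \<in> S - M" "v1 \<in> S" "b v0 v1 \<noteq> 0" by blast
    define k where "k = c v0 v1 / b v0 v1"
    have k0: "c v0 v' = k * b v0 v'" if "v' \<in> S" for v'
      using ratio[OF v0(1) that v0(2)] v0(3) by (simp add: k_def field_simps)
    have sub: "E.subspace {w \<in> S. b v w = 0}" for v
      using subspace_S by (auto simp: E.subspace_def b_def fun_scale_def)
    have "c v v' = k * b v v'" if v: "v \<in> S - M" "v' \<in> S" for v v'
    proof (cases "\<forall>w\<in>S. b v w = 0")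
      case True
      then show ?thesis using zero[OF v] v by simp
    next
      case False
      \<comment> \<open>Such a \<open>w\<close> pairs non-trivially with both \<open>v\<close> and
        \<open>v0\<close>, so skew-symmetry carries the factor \<open>k\<close> from
        \<open>v0\<close> to \<open>w\<close> and on to \<open>v\<close>.\<close>
      have "\<exists>w\<in>S. w \<notin> M \<and> w \<notin> {w \<in> S. b v w = 0} \<and> w \<notin> {w \<in> S. b v0 w = 0}"
        by (rule E.three_proper_subspaces_no_cover[OF field_gt_2 subspace_S M(1) _ sub _ sub])
          (use M(2) False v0 in auto)
      then obtain w where w: "w \<in> S - M" "b v w \<noteq> 0" "b v0 w \<noteq> 0" by blast
      have wv0: "c w v0 = k * b w v0" "b w v0 \<noteq> 0"
        using k0[of w] c_swap[of w v0] b_swap[of w v0] w v0(1) by auto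
      have "c w v * b w v0 = k * b w v0 * b w v"
        using ratio[OF w(1), of v v0] v v0(1) wv0(1) by simp
      then have "c w v = k * b w v" using wv0(2) by simp
      then have "c v w = k * b v w" using c_swap[of v w] b_swap[of v w] v w(1) by simp
      then have "c v v' * b v w = k * b v w * b v v'" using ratio[OF v(1), of v' w] v w(1) by simp
      then show ?thesis using w(2) by simp
    qed
    then show ?thesis by blast
  qed
  then obtain k where k: "\<And>v v'. v \<in> S - M \<Longrightarrow> v' \<in> S \<Longrightarrow> c v v' = k * b v v'" by blast
  have "\<forall>v'\<in>S. c v v' = k * b v v'" if "v \<in> S" for v
  proof (rule eq_on_complement[OF M(1,2) _ _ that])
    show "\<forall>v'\<in>S. c v v' = k * b v v'" if "v \<in> S - M" for v using k that by blast
    fix v w assume "\<forall>v'\<in>S. c (v + w) v' = k * b (v + w) v'" "\<forall>v'\<in>S. c w v' = k * b w v'"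
    then show "\<forall>v'\<in>S. c v v' = k * b v v'" by (simp add: c_def b_def distrib_left)
  qed
  then show ?thesis unfolding b_def c_def by blast
qed

text \<open>If \<open>k\<close> is the factor of proportionality for \<open>y\<close>, then \<open>y' = y - k x\<close> satisfies \<open>S y' \<subseteq> L x\<close>. Hence
  \<open>wedge y' (v x)\<close> lies in \<open>S\<close> and kills \<open>x\<close>, so it maps \<open>v' x\<close>, up to a factor, to \<open>y' \<in> T x\<close>; by
  minimality \<open>L x = T x\<close>.\<close>

lemma minimal_T_isotropic:
  assumes x: "x \<in> H" "x \<noteq> 0" and nz: "\<exists>u\<in>S. u x \<noteq> 0"
    and minimal: "\<And>y. y \<in> H \<Longrightarrow> y \<noteq> 0 \<Longrightarrow> dim (T x) \<le> dim (T y)"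
    and y0: "y0 \<in> L x" "\<And>c. y0 \<noteq> c *s x"
    and v: "v \<in> S" "v' \<in> S"
  shows "s (v x) (v' x) = 0"
proof (rule ccontr)
  assume b: "s (v x) (v' x) \<noteq> 0"
  have key: "\<exists>y'. y' \<noteq> 0 \<and> y' \<in> T x \<and> T y' \<subseteq> L x \<and> y \<in> T x"
    if y: "y \<in> L x" "\<And>c. y \<noteq> c *s x" for y
  proof -
    obtain k where k: "\<And>v v'. v \<in> S \<Longrightarrow> v' \<in> S \<Longrightarrow> s (v y) (v' x) = k * s (v x) (v' x)"
      using proportional_forms[OF x nz y(1)] by blast
    define y' where "y' = y - k *s x"
    have "x \<in> L x" using x S_zero by (simp add: L_def)
    then have y'L: "y' \<in> L x" using y(1) subspace_diff[OF subspace_L] subspace_scale[OF subspace_L]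
      unfolding y'_def by blast
    have img: "w y' \<in> L x" if w: "w \<in> S" for w
    proof -
      have "s t (w y') = 0" if t: "t \<in> T x" for t
      proof -
        obtain c u where u: "u \<in> S" "t = c *s x + u x" using t by (auto simp: T_def)
        have "s (w x) y' = 0" using L_T_orthogonal[OF y'L image_in_T[OF w]] s_eq_0_swap by blast
        then have "s x (w y') = 0" using S_simps(2)[OF w] by simp
        moreover have "s (w y') (u x) = 0" using k[OF w u(1)] by (simp add: y'_def S_simps[OF w])
        then have "s (u x) (w y') = 0" using s_eq_0_swap by blast
        ultimately show ?thesis by (simp add: u(2))
      qed
      then show ?thesis unfolding in_L_iff[OF x] using S_range[OF w] by blast
    qed
    have y'0: "y' \<noteq> 0" "y' \<in> H" using y y'L by (auto simp: y'_def L_def)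
    have TL: "T y' \<subseteq> L x"
      using y'L img subspace_add[OF subspace_L] subspace_scale[OF subspace_L] by (auto simp: T_def)
    \<comment> \<open>\<open>L y'\<close> is the orthogonal of \<open>T y'\<close>, and
      \<open>T y'\<close> lies in \<open>L x\<close>, which is orthogonal to
      \<open>v x\<close>.\<close>
    have "v x \<in> L y'"
      unfolding in_L_iff[OF y'0(2,1)]
      using TL L_T_orthogonal[OF _ image_in_T[OF v(1)]] S_range[OF v(1)] by blast
    then have w: "wedge y' (v x) \<in> S" by (simp add: L_def)
    have yx: "s y' x = 0" using L_T_orthogonal[OF y'L x_in_T] .
    have "wedge y' (v x) x = 0"
      using yx s_eq_0_swap[of "v x" x] s_x_T[OF image_in_T[OF v(1)]] by (simp add: wedge_def)
    then have "wedge y' (v x) (v' x) \<in> T x" by (rule stabilizer_T[OF x w _ image_in_T[OF v(2)]])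
    then have "- s (v x) (v' x) *s y' \<in> T x"
      using L_T_orthogonal[OF y'L image_in_T[OF v(2)]] by (simp add: wedge_def)
    then have "(- inverse (s (v x) (v' x))) *s (- s (v x) (v' x) *s y') \<in> T x"
      by (rule subspace_scale[OF subspace_T])
    then have y'T: "y' \<in> T x" using b by simp
    have "y = y' + k *s x" by (simp add: y'_def)
    also have "\<dots> \<in> T x" using y'T x_in_T subspace_add[OF subspace_T] subspace_scale[OF subspace_T] by blast
    finally show ?thesis using y'0(1) y'T TL by blast
  qed
  have LT: "L x \<subseteq> T x"
  proof
    fix y assume "y \<in> L x"
    then show "y \<in> T x" using key[of y] x_in_T subspace_scale[OF subspace_T] by metis
  qed
  obtain y' where y': "y' \<noteq> 0" "y' \<in> T x" "T y' \<subseteq> L x" using key[OF y0] by blast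
  have "dim (T x) \<le> dim (T y')" using minimal y' T_subset[OF x(1)] by blast
  also have "\<dots> \<le> dim (L x)" using dim_subset[OF y'(3)] .
  finally have "L x = T x" using subspace_dim_equal[OF subspace_L subspace_T LT] by simp
  then show False using L_T_orthogonal[of "v x" x "v' x"] image_in_T v b by blast
qed

lemma ex_large_L:
  assumes "u \<in> S" "z \<in> H" "u z \<noteq> 0"
  obtains x where "x \<in> H" "x \<noteq> 0" "2 \<le> dim (L x)"
proof -
  have "z \<noteq> 0" using assms S_simps(6)[OF assms(1)] by auto
  then obtain q w y where q: "0 < q" "q \<le> m" "w \<in> S" "y \<in> H" "(w ^^ (q - 1)) y \<noteq> 0"
    "\<And>u x. u \<in> S \<Longrightarrow> x \<in> H \<Longrightarrow> (u ^^ q) x = 0"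
    using maximal_nilpotency_index[OF assms(2) \<open>z \<noteq> 0\<close> subset_refl] by blast
  have "q \<noteq> 1" using q(6)[OF assms(1,2)] assms(3) by auto
  then have "q = Suc (Suc (q - 2))" using q(1) by linarith
  then obtain r where r: "q = Suc (Suc r)" by blast
  define x where "x = (w ^^ (q - 1)) y"
  have xH: "x \<in> H" "x \<noteq> 0" using q funpow_in_H by (simp_all add: x_def)
  have "x = w ((w ^^ r) y)" by (simp add: x_def r)
  then have xw: "x \<in> w ` H" using funpow_in_H[OF q(3,4)] by blast
  have lin: "Vector_Spaces.linear scale scale w" by (rule alternating_endosD(1)[OF S_alternating[OF q(3)]])
  have sw: "subspace (w ` H)"
    using module_hom.subspace_image[OF Vector_Spaces.linear.axioms(3)[OF lin] subspace_H] .
  have "v x \<in> w ` H" if "v \<in> S" for v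
    unfolding x_def
    by (rule image_power_in_image[OF field_ge subspace_H _ q(1,2) _ q(3) that q(4)]) (use S_range q(6) in auto)
  then have Tw: "T x \<subseteq> w ` H"
    using xw subspace_add[OF sw] subspace_scale[OF sw] by (auto simp: T_def)
  \<comment> \<open>Yields a second kernel vector \<open>x'\<close>: \<open>s y x' = s x z'\<close>
    is nonzero while \<open>s y x = 0\<close>, so \<open>x'\<close> is no multiple of
    \<open>x\<close>.\<close>
  obtain z' where z': "z' \<in> H" "s x z' \<noteq> 0" using nondeg_H xH unfolding nondeg_def by blast
  define x' where "x' = (w ^^ (q - 1)) z'"
  have wx: "w x = 0" "w x' = 0" using q(6)[OF q(3,4)] q(6)[OF q(3) z'(1)] by (simp_all add: x_def x'_def r)
  have "k \<in> L x" if "w k = 0" "k \<in> H" for k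
    unfolding in_L_iff[OF xH] using that Tw S_simps(2)[OF q(3), of k] s_eq_0_swap[of _ k] by fastforce
  then have "x \<in> L x" "x' \<in> L x" using wx xH funpow_in_H[OF q(3) z'(1)] by (auto simp: x'_def)
  moreover have "x' \<notin> span {x}"
  proof
    assume "x' \<in> span {x}"
    then obtain c where "x' = c *s x" by (auto simp: span_singleton)
    then have "s y x' = 0" using funpow_alternating(3)[OF S_alternating[OF q(3)], of 0 y "q - 1"] by (simp add: x_def)
    then show False using z'(2) funpow_alternating(2)[OF S_alternating[OF q(3)], of "q - 1" y z'] by (simp add: x_def x'_def)
  qed
  ultimately have "dim (span {x', x}) = 2" "span {x', x} \<subseteq> L x"
    using xH(2) by (simp add: dim_insert, intro span_minimal subspace_L, simp)
  then have "2 \<le> dim (L x)" using dim_subset by metis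
  then show ?thesis using that xH by blast
qed

theorem common_kernel:
  assumes "0 < m"
  shows "\<exists>e\<in>H. e \<noteq> 0 \<and> (\<forall>u\<in>S. u e = 0)"
proof (rule ccontr)
  assume no: "\<not> ?thesis"
  then have nz: "\<exists>u\<in>S. u x \<noteq> 0" if "x \<in> H" "x \<noteq> 0" for x using that by blast
  have "\<not> H \<subseteq> {0}" using dim_H dim_eq_0[of H] assms by auto
  then obtain h where h: "h \<in> H" "h \<noteq> 0" by blast
  obtain x0 where x0: "x0 \<in> H" "x0 \<noteq> 0" "2 \<le> dim (L x0)"
    using ex_large_L nz[OF h] h by metis
  obtain x where x: "x \<in> H" "x \<noteq> 0" "\<And>y. y \<in> H \<Longrightarrow> y \<noteq> 0 \<Longrightarrow> dim (T x) \<le> dim (T y)"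
    using ex_has_least_nat[of "\<lambda>x. x \<in> H \<and> x \<noteq> 0" h "\<lambda>x. dim (T x)"] h by blast
  have sum: "dim (T y) + dim (L y) = 2 * m" if "y \<in> H" "y \<noteq> 0" for y
    using dim_perp[OF nondeg_H subspace_T T_subset[OF that(1)]] L_eq[OF that] dim_H by simp
  \<comment> \<open>The dimensions of \<open>T\<close> and \<open>L\<close> have constant sum, so
    least \<open>T x\<close> means largest \<open>L x\<close>.\<close>
  have "2 \<le> dim (L x)" using x(3)[OF x0(1,2)] sum[OF x0(1,2)] sum[OF x(1,2)] x0(3) by linarith
  then have "\<not> L x \<subseteq> span {x}" using dim_subset[of "L x" "span {x}"] x(2) by auto
  then obtain y0 where y0: "y0 \<in> L x" "\<And>c. y0 \<noteq> c *s x" by (auto simp: span_singleton)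
  note iso = minimal_T_isotropic[OF x(1,2) nz[OF x(1,2)] x(3) y0]
  obtain M where M: "E.subspace M" "M \<subset> S"
    "\<And>v t. v \<in> S - M \<Longrightarrow> t \<in> T x \<Longrightarrow> s t (v x) = 0 \<Longrightarrow> v t \<in> T x"
    using generic_elements[OF x(1,2) nz[OF x(1,2)]] by metis
  let ?W = "T x"
  \<comment> \<open>Isotropy of \<open>T x\<close> meets the orthogonality condition for generic
    \<open>v\<close>; taking differences then reaches all of \<open>S\<close>.\<close>
  have "\<forall>t\<in>?W. v t \<in> ?W" if "v \<in> S" for v
  proof (rule eq_on_complement[OF M(1,2) _ _ that])
    fix v assume v: "v \<in> S - M"
    have "s t (v x) = 0" if "t \<in> ?W" for t
      using that iso s_x_T[OF image_in_T, of v x] v by (auto simp: T_def)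
    then show "\<forall>t\<in>?W. v t \<in> ?W" using M(3) v by blast
  next
    fix v w assume "\<forall>t\<in>?W. (v + w) t \<in> ?W" "\<forall>t\<in>?W. w t \<in> ?W"
    then have "(v + w) t - w t \<in> ?W" if "t \<in> ?W" for t using that subspace_diff[OF subspace_T] by blast
    then show "\<forall>t\<in>?W. v t \<in> ?W" by simp
  qed
  then have stable: "\<And>v t. v \<in> S \<Longrightarrow> t \<in> ?W \<Longrightarrow> v t \<in> ?W" by blast
  have TW: "T y = ?W" if "y \<in> ?W" "y \<noteq> 0" for y
  proof (rule subspace_dim_equal[OF subspace_T subspace_T])
    show "T y \<subseteq> ?W"
      using that stable subspace_add[OF subspace_T] subspace_scale[OF subspace_T] by (auto simp: T_def[of y])
    show "dim ?W \<le> dim (T y)" using x(3) that T_subset[OF x(1)] by blast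
  qed
  obtain q w y where q: "0 < q" "q \<le> m" "w \<in> S" "y \<in> ?W" "(w ^^ (q - 1)) y \<noteq> 0"
    "\<And>u z. u \<in> S \<Longrightarrow> z \<in> ?W \<Longrightarrow> (u ^^ q) z = 0"
    using maximal_nilpotency_index[OF x_in_T x(2) T_subset[OF x(1)]] by blast
  define e where "e = (w ^^ (q - 1)) y"
  have "(w ^^ k) y \<in> ?W" for k by (induction k) (auto simp: q(4) stable[OF q(3)])
  then have e: "e \<in> ?W" "e \<noteq> 0" using q(5) by (auto simp: e_def)
  have we: "w e = 0" using q(6)[OF q(3,4)] q(1) by (cases q) (simp_all add: e_def)
  \<comment> \<open>The first-order argument puts \<open>u e\<close> in the image of
    \<open>T x\<close> under \<open>w\<close>. Since \<open>T x = T e\<close> and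
    \<open>w e = 0\<close>, that image is already attained on S e.\<close>
  have step: "\<exists>u'\<in>S. u e = w (u' e)" if "u \<in> S" for u
  proof -
    have "u e \<in> w ` ?W"
      unfolding e_def
      by (rule image_power_in_image[OF field_ge subspace_T _ q(1,2) _ q(3) that q(4)]) (use stable q(6) in auto)
    then obtain t where t: "t \<in> T e" "u e = w t" using TW[OF e] by blast
    then show ?thesis using we by (auto simp: T_def S_simps[OF q(3)])
  qed
  have iter: "\<exists>u'\<in>S. u e = (w ^^ k) (u' e)" if "u \<in> S" for u k
  proof (induction k)
    case 0 then show ?case using that by auto
  next
    case (Suc k)
    then obtain u' where "u' \<in> S" "u e = (w ^^ k) (u' e)" by blast
    then show ?case using step[of u'] by (auto simp: funpow_swap1)
  qed
  \<comment> \<open>After \<open>q\<close> rounds \<open>u e\<close> lies in the image of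
    \<open>T x\<close> under \<open>w ^^ q\<close>, which is 0.\<close>
  have "u e = 0" if "u \<in> S" for u
    using iter[OF that, of q] q(6)[OF q(3)] image_in_T[of _ e] TW[OF e] by metis
  then show False using no e T_subset[OF x(1)] by blast
qed

end

section \<open>Classification and matrices\<close>

context fd_symplectic
begin

text \<open>If \<open>S\<close> kills \<open>e\<close>, then \<open>T e\<close> is the line of
  \<open>e\<close> and \<open>L e\<close> its whole orthogonal in \<open>H\<close>. So
  \<open>S\<close> contains every \<open>wedge e h\<close> with \<open>h\<close> in that orthogonal,
  and is the full preimage of its induced space.\<close>

theorem extremal_triangular_model:
  assumes "nilpotent_alternating scale s Basis H S m" "has_dim (fun_scale scale) S (m * (m - 1))"
    and F: "infinite (UNIV :: 'f set) \<or> 2 < card (UNIV :: 'f set)"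
    and "infinite (UNIV :: 'f set) \<or> m \<le> card (UNIV :: 'f set)"
  shows "triangular_model H S"
  using assms(1,2,4)
proof (induction m arbitrary: H S)
  case 0
  interpret nilpotent_alternating scale s Basis H S 0 by (rule 0)
  have "H = {0}" using dim_H subspace_H subspace_0 by (auto simp: dim_eq_0)
  then have "u = 0" if "u \<in> S" for u using S_range[OF that] by (auto simp: fun_eq_iff)
  then have "S = {0}" using S_zero by auto
  with \<open>H = {0}\<close> show ?case using triangular_model.zero by simp
next
  case (Suc m)
  interpret nilpotent_alternating scale s Basis H S "Suc m" by (rule Suc.prems)
  have IH: "triangular_model (perp H {x, f}) ((\<lambda>u. proj x f \<circ> u \<circ> proj x f) ` {u \<in> S. u x = 0})"
    if "x \<in> H" "f \<in> H" "s x f = 1" for x f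
    using Suc.IH[of "perp H {x, f}"] nilpotent_alternating_quotient(1)[OF that]
      extremal(3)[OF Suc.prems(2) that] Suc.prems(3) by auto
  interpret extremal_nilpotent scale s Basis H S "Suc m"
  proof
    fix x assume x: "x \<in> H" "x \<noteq> 0"
    then obtain f where f: "f \<in> H" "s x f = 1" using nondeg_dual[OF nondeg_H] by metis
    show "L x = perp H (T x)" "T x = perp H (L x)" using extremal(1,2)[OF Suc.prems(2) x(1) f] by auto
  qed (use IH model_regular_generators F Suc.prems(3) in auto)
  obtain e where e: "e \<in> H" "e \<noteq> 0" "\<And>u. u \<in> S \<Longrightarrow> u e = 0" using common_kernel by blast
  then obtain f where f: "f \<in> H" "s e f = 1" using nondeg_dual[OF nondeg_H] by metis
  let ?p = "proj e f"
  let ?S' = "(\<lambda>u. ?p \<circ> u \<circ> ?p) ` {u \<in> S. u e = 0}"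
  have wedge_S: "wedge e h \<in> S" if "h \<in> H" "s e h = 0" for h
  proof -
    have "s t h = 0" if "t \<in> T e" for t
    proof -
      obtain c u where "u \<in> S" "t = c *s e + u e" using \<open>t \<in> T e\<close> by (auto simp: T_def)
      then show ?thesis using e(3)[of u] \<open>s e h = 0\<close> by simp
    qed
    then have "h \<in> L e" unfolding in_L_iff[OF e(1,2)] using that by blast
    then show ?thesis by (simp add: L_def)
  qed
  have "u \<in> S" if u: "u \<in> A" "range u \<subseteq> H" "u e = 0" "?p \<circ> u \<circ> ?p \<in> ?S'" for u
  proof -
    obtain w where w: "w \<in> S" "?p \<circ> u \<circ> ?p = ?p \<circ> w \<circ> ?p" using u(4) by auto
    have "?p (u (?p z)) = ?p (w (?p z))" for z using fun_cong[OF w(2), of z] by simp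
    then have dec: "u z = w z + wedge e (u f - w f) z" for z
      using alternating_decomposition[OF f(2) u(1,3), of z]
        alternating_decomposition[OF f(2) S_alternating[OF w(1)] e(3)[OF w(1)], of z]
      by (simp add: wedge_diff)
    have eq: "u = w + wedge e (u f - w f)"
      by (rule ext) (unfold plus_fun_apply, rule dec)
    have "u f - w f \<in> H" using u(2) S_range[OF w(1)] subspace_diff[OF subspace_H] by auto
    moreover have "s e (u f - w f) = 0"
      using alternating_endosD(3)[OF u(1), of e f] S_simps(2)[OF w(1), of e f] u(3) e(3)[OF w(1)] by simp
    ultimately have "w + wedge e (u f - w f) \<in> S" by (intro S_add w(1) wedge_S)
    then show ?thesis by (subst eq)
  qed
  then have "S = {u \<in> A. range u \<subseteq> H \<and> u e = 0 \<and> ?p \<circ> u \<circ> ?p \<in> ?S'}"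
    using S_alternating S_range e(3) by blast
  then show ?case using triangular_model.step[OF nondeg_H e(1) f IH[OF e(1) f]] by simp
qed

section \<open>Symplectic bases and matrix representation\<close>

definition symplectic_family :: "nat \<Rightarrow> (nat \<Rightarrow> 'v) \<Rightarrow> (nat \<Rightarrow> 'v) \<Rightarrow> bool" where
  "symplectic_family m e f \<longleftrightarrow> (\<forall>i<m. \<forall>j<m. s (e i) (e j) = 0 \<and> s (f i) (f j) = 0 \<and>
     s (e i) (f j) = (if i = j then 1 else 0))"

text \<open>Unrolls the recursion of the model: the successive vectors \<open>e\<close> span a flag
  of a Lagrangian subspace, and the conditions on the complements say that \<open>u\<close> strictly
  lowers this flag.\<close>

lemma model_symplectic_family:
  assumes "triangular_model H S" "dim H = 2 * m"
  shows "\<exists>e f. e ` {..<m} \<subseteq> H \<and> f ` {..<m} \<subseteq> H \<and> symplectic_family m e f \<and>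
    S = {u \<in> A. range u \<subseteq> H \<and> (\<forall>i<m. u (e i) \<in> span (e ` {..<i}))}"
  using assms
proof (induction arbitrary: m rule: triangular_model.induct)
  case zero
  have "(0 :: 'v \<Rightarrow> 'v) \<in> A"
    by (auto simp: alternating_endos_def Vector_Spaces.linear_iff vector_space_axioms)
  then have "{u \<in> A. range u \<subseteq> {0}} = {0}" by (auto simp: fun_eq_iff image_subset_iff)
  then show ?case using zero by (auto simp: symplectic_family_def)
next
  case (step H e f S')
  let ?p = "proj e f"
  note ef = \<open>s e f = 1\<close>
  have sH: "subspace H" using step nondeg_def by simp
  have "dim H = dim (perp H {e, f}) + 2" using nondeg_perp_pair(2)[OF ef step(1-3)] .
  moreover from this obtain k where "m = Suc k" using step.prems by (cases m) auto
  ultimately have k: "m = Suc k" "dim (perp H {e, f}) = 2 * k" using step.prems by auto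
  obtain e' f' where IH: "e' ` {..<k} \<subseteq> perp H {e, f}" "f' ` {..<k} \<subseteq> perp H {e, f}" "symplectic_family k e' f'"
    "S' = {u \<in> A. range u \<subseteq> perp H {e, f} \<and> (\<forall>i<k. u (e' i) \<in> span (e' ` {..<i}))}"
    using step.IH[OF k(2)] by blast
  define E where "E = case_nat e e'"
  define G where "G = case_nat f f'"
  have perp: "e' i \<in> H" "f' i \<in> H" "s e (e' i) = 0" "s f (e' i) = 0" "s e (f' i) = 0" "s f (f' i) = 0"
    "s (e' i) e = 0" "s (e' i) f = 0" "s (f' i) e = 0" "s (f' i) f = 0" if "i < k" for i
    using IH(1,2) that s_eq_0_swap[of _ e] s_eq_0_swap[of _ f] by (auto simp: perp_def)
  have EH: "E ` {..<m} \<subseteq> H" "G ` {..<m} \<subseteq> H"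
    using perp step(2,3) by (auto simp: E_def G_def k less_Suc_eq_0_disj)
  have fam: "symplectic_family m E G"
    using IH(3) perp ef by (auto simp: symplectic_family_def E_def G_def k less_Suc_eq_0_disj)
  have img: "E ` {..<Suc j} = insert e (e' ` {..<j})" for j
    by (auto simp: E_def lessThan_Suc_eq_insert_0 image_image)
  have "(u e = 0 \<and> ?p \<circ> u \<circ> ?p \<in> S') \<longleftrightarrow> (\<forall>i<m. u (E i) \<in> span (E ` {..<i}))"
    if u: "u \<in> A" "range u \<subseteq> H" for u
  proof -
    have "(\<forall>i<m. u (E i) \<in> span (E ` {..<i})) \<longleftrightarrow>
        u e = 0 \<and> (\<forall>j<k. u (e' j) \<in> span (insert e (e' ` {..<j})))"
      by (simp add: k(1) All_less_Suc2 img del: lessThan_Suc) (simp add: E_def)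
    moreover have "?p \<circ> u \<circ> ?p \<in> S' \<longleftrightarrow> (\<forall>j<k. ?p (u (e' j)) \<in> span (e' ` {..<j}))"
    proof -
      have "range (?p \<circ> u \<circ> ?p) \<subseteq> perp H {e, f}"
        using proj_in_perp[OF ef sH step(2,3)] u(2) by auto
      moreover have "?p (e' j) = e' j" if "j < k" for j using perp[OF that] by (simp add: proj_def)
      ultimately show ?thesis using proj_conj_alternating[OF ef u(1)] by (simp add: IH(4))
    qed
    \<comment> \<open>As \<open>u e = 0\<close>, the vector \<open>u (e' j)\<close> is orthogonal to
      \<open>e\<close>, so \<open>?p\<close> changes it only by a multiple of \<open>e\<close>; and
      \<open>?p\<close> fixes the span of the \<open>e'\<close>.\<close>
    moreover have "?p (u (e' j)) \<in> span (e' ` {..<j}) \<longleftrightarrow> u (e' j) \<in> span (insert e (e' ` {..<j}))"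
      if "u e = 0" "j < k" for j
    proof
      have "s e (u (e' j)) = 0" using alternating_endosD(3)[OF u(1), of e] that(1) by simp
      then have "?p (u (e' j)) = u (e' j) - (- s f (u (e' j))) *s e" by (simp add: proj_def)
      then show "?p (u (e' j)) \<in> span (e' ` {..<j}) \<Longrightarrow> u (e' j) \<in> span (insert e (e' ` {..<j}))"
        unfolding span_breakdown_eq by metis
      assume "u (e' j) \<in> span (insert e (e' ` {..<j}))"
      then obtain c where c: "u (e' j) - c *s e \<in> span (e' ` {..<j})" unfolding span_breakdown_eq by blast
      have "subspace {z. ?p z = z}" by (auto simp: subspace_def)
      then have "span (e' ` {..<j}) \<subseteq> {z. ?p z = z}"
        using perp that(2) by (intro span_minimal) (auto simp: proj_def)
      then have "?p (u (e' j) - c *s e) = u (e' j) - c *s e" using c by blast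
      then have "?p (u (e' j)) = u (e' j) - c *s e" using proj_simps(1)[OF ef] by (simp add: proj_diff)
      then show "?p (u (e' j)) \<in> span (e' ` {..<j})" using c by simp
    qed
    ultimately show ?thesis by blast
  qed
  then have "{u \<in> A. range u \<subseteq> H \<and> u e = 0 \<and> ?p \<circ> u \<circ> ?p \<in> S'} =
      {u \<in> A. range u \<subseteq> H \<and> (\<forall>i<m. u (E i) \<in> span (E ` {..<i}))}" by blast
  then show ?case using EH fam by blast
qed

context
  fixes n e f and b d :: "nat \<Rightarrow> 'v"
  assumes family: "symplectic_family n e f" and dim_UNIV_eq: "dim (UNIV :: 'v set) = 2 * n"
  defines "b \<equiv> \<lambda>i. if i < n then e i else f (i - n)"
    and "d \<equiv> \<lambda>i. if i < n then f i else - e (i - n)"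
begin

lemma family_simps [simp]:
  "i < n \<Longrightarrow> j < n \<Longrightarrow> s (e i) (e j) = 0" "i < n \<Longrightarrow> j < n \<Longrightarrow> s (f i) (f j) = 0"
  "i < n \<Longrightarrow> j < n \<Longrightarrow> s (e i) (f j) = (if i = j then 1 else 0)"
  "i < n \<Longrightarrow> j < n \<Longrightarrow> s (f i) (e j) = (if i = j then - 1 else 0)"
  using family s_swap[of "f i" "e j"] by (auto simp: symplectic_family_def)

text \<open>The signs make \<open>d\<close> the \<open>s\<close>-dual family of \<open>b\<close>, so that coordinates in \<open>b\<close> are pairings with \<open>d\<close>.\<close>

lemma dual_basis: "i < 2 * n \<Longrightarrow> j < 2 * n \<Longrightarrow> s (b i) (d j) = (if i = j then 1 else 0)"
  by (auto simp: b_def d_def)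

lemma inj_b: "inj_on b {..<2 * n}"
proof (rule inj_onI)
  fix i j assume ij: "i \<in> {..<2 * n}" "j \<in> {..<2 * n}" and eq: "b i = b j"
  have "s (b j) (d i) = 1" using dual_basis[of i i] ij by (simp flip: eq)
  then show "i = j" using dual_basis[of j i] ij by (simp split: if_splits)
qed

lemma independent_b: "\<not> dependent (b ` {..<2 * n})"
proof
  assume "dependent (b ` {..<2 * n})"
  then obtain i where i: "i < 2 * n" "b i \<in> span (b ` {..<2 * n} - {b i})" by (auto simp: dependent_def)
  have "subspace {z. s z (d i) = 0}" by (auto simp: subspace_def)
  then have "span (b ` {..<2 * n} - {b i}) \<subseteq> {z. s z (d i) = 0}"
    using dual_basis[OF _ i(1)] by (intro span_minimal) auto
  then show False using i dual_basis[of i i] by auto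
qed

lemma span_b: "span (b ` {..<2 * n}) = UNIV"
  using card_ge_dim_independent[of "b ` {..<2 * n}" UNIV] independent_b card_image[OF inj_b] dim_UNIV_eq by auto

lemma symplectic_basis_b: "symplectic_basis scale s n b"
  unfolding symplectic_basis_def is_ordered_basis_def
  using inj_b independent_b span_b
  by (auto simp: gram_matrix_def b_def intro!: eq_matI)

lemma representation_b:
  assumes "i < 2 * n"
  shows "representation (b ` {..<2 * n}) v (b i) = s v (d i)"
proof -
  let ?B = "b ` {..<2 * n}"
  have s_sum: "s (sum g I) y = (\<Sum>i\<in>I. s (g i) y)" for g :: "nat \<Rightarrow> 'v" and I y
    by (induction I rule: infinite_finite_induct) auto
  have "v = (\<Sum>a\<in>?B. representation ?B v a *s a)"
    using sum_representation_eq[OF independent_b, of v ?B] span_b by simp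
  also have "\<dots> = (\<Sum>j<2 * n. representation ?B v (b j) *s b j)"
    by (simp add: sum.reindex[OF inj_b])
  finally have "s v (d i) = s (\<Sum>j<2 * n. representation ?B v (b j) *s b j) (d i)" by simp
  also have "\<dots> = (\<Sum>j<2 * n. representation ?B v (b j) * (if j = i then 1 else 0))"
    by (simp add: s_sum dual_basis[OF _ assms])
  also have "\<dots> = representation ?B v (b i)" using assms by (simp add: sum.delta if_distrib cong: if_cong)
  finally show ?thesis by simp
qed

lemma matrix_of_endo_b:
  "matrix_of_endo scale (2 * n) b u = mat (2 * n) (2 * n) (\<lambda>(i, j). s (u (b j)) (d i))"
  unfolding matrix_of_endo_def by (rule eq_matI) (auto simp: representation_b)

lemma span_e_orthogonal:
  assumes "j \<le> n" "v \<in> span (e ` {..<j})"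
  shows "i < n \<Longrightarrow> s v (e i) = 0" "j \<le> i \<Longrightarrow> i < n \<Longrightarrow> s v (f i) = 0"
proof -
  have sub: "subspace {z. s z y = 0}" for y by (auto simp: subspace_def)
  show "s v (e i) = 0" if "i < n"
  proof -
    have "e ` {..<j} \<subseteq> {z. s z (e i) = 0}" using assms(1) that by auto
    then show ?thesis using span_minimal[OF _ sub[of "e i"]] assms(2) by blast
  qed
  show "s v (f i) = 0" if "j \<le> i" "i < n"
  proof -
    have "e ` {..<j} \<subseteq> {z. s z (f i) = 0}" using assms(1) that by auto
    then show ?thesis using span_minimal[OF _ sub[of "f i"]] assms(2) by blast
  qed
qed

text \<open>Self-adjointness of \<open>u\<close> makes the lower right block the transpose of the
  upper left one, and \<open>s z (u z) = 0\<close> makes \<open>B\<close> alternating. The lower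
  left block vanishes because \<open>u\<close> keeps the span of the \<open>e\<close>
  isotropic.\<close>

lemma matrix_in_NT:
  assumes u: "u \<in> A" "\<And>i. i < n \<Longrightarrow> u (e i) \<in> span (e ` {..<i})"
  shows "matrix_of_endo scale (2 * n) b u \<in> NT_triangle_zero n"
proof -
  define U where "U = mat n n (\<lambda>(i, j). s (u (e j)) (f i))"
  define B where "B = mat n n (\<lambda>(i, j). s (u (f j)) (f i))"
  note ul = alternating_endosD[OF u(1)]
  have "matrix_of_endo scale (2 * n) b u = four_block_mat U B (0\<^sub>m n n) (U\<^sup>T)"
  proof (rule eq_matI)
    fix i j assume "i < dim_row (four_block_mat U B (0\<^sub>m n n) (U\<^sup>T))" "j < dim_col (four_block_mat U B (0\<^sub>m n n) (U\<^sup>T))"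
    then have ij: "i < 2 * n" "j < 2 * n" by (auto simp: U_def)
    have z: "s (u (e j)) (e (i - n)) = 0" if "j < n" "\<not> i < n"
      using span_e_orthogonal(1)[OF _ u(2)[OF that(1)], of "i - n"] that ij by auto
    have t: "- s (u (f (j - n))) (e (i - n)) = s (u (e (i - n))) (f (j - n))"
      using ul(3)[of "e (i - n)" "f (j - n)"] s_swap[of "e (i - n)" "u (f (j - n))"] by simp
    show "matrix_of_endo scale (2 * n) b u $$ (i, j) = four_block_mat U B (0\<^sub>m n n) (U\<^sup>T) $$ (i, j)"
      unfolding matrix_of_endo_b using ij z t by (auto simp: U_def B_def b_def d_def)
  qed (auto simp: matrix_of_endo_b U_def)
  moreover have "U \<in> strictly_upper_triangular_mats n"
    using span_e_orthogonal(2)[OF _ u(2)] by (auto simp: strictly_upper_triangular_mats_def U_def)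
  moreover have "B \<in> alternating_mats n"
  proof -
    have anti: "s (u (f i)) (f j) = - s (u (f j)) (f i)" for i j
      using ul(3)[of "f i" "f j"] s_swap[of "f i" "u (f j)"] by simp
    have "s (u (f i)) (f i) = 0" for i using ul(2)[of "f i"] s_eq_0_swap by blast
    moreover have "B\<^sup>T = - B"
    proof (rule eq_matI)
      fix i j assume "i < dim_row (- B)" "j < dim_col (- B)"
      then show "B\<^sup>T $$ (i, j) = (- B) $$ (i, j)" using anti[of i j] by (simp add: B_def)
    qed (simp_all add: B_def)
    ultimately show ?thesis by (simp add: alternating_mats_def B_def)
  qed
  ultimately show ?thesis unfolding NT_triangle_zero_def by blast
qed

lemma NT_matrix_realized:
  assumes U: "U \<in> strictly_upper_triangular_mats n" and B: "B \<in> alternating_mats n"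
  shows "\<exists>u\<in>A. (\<forall>i<n. u (e i) \<in> span (e ` {..<i})) \<and>
    matrix_of_endo scale (2 * n) b u = four_block_mat U B (0\<^sub>m n n) (U\<^sup>T)"
proof -
  \<comment> \<open>\<open>wedge (e p) (f q)\<close> sends \<open>e q\<close> to \<open>e p\<close>
    and \<open>f p\<close> to \<open>f q\<close>, which fills \<open>U\<close> and its transpose at
    once. Each pair \<open>p < q\<close> fills both entries of \<open>B\<close>, the sign matching
    \<open>wedge (e p) (e q)\<close>, which sends \<open>f p\<close> to \<open>e q\<close> and
    \<open>f q\<close> to \<open>- e p\<close>.\<close>
  define u where "u z = (\<Sum>p<n. \<Sum>q<n. U $$ (p, q) *s wedge (e p) (f q) z +
    (if p < q then - B $$ (p, q) else 0) *s wedge (e p) (e q) z)" for z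
  have s_sum: "s y (sum g I) = (\<Sum>i\<in>I. s y (g i))" "s (sum g I) y = (\<Sum>i\<in>I. s (g i) y)" for g :: "nat \<Rightarrow> 'v" and I y
    by (induction I rule: infinite_finite_induct) auto
  note wl = alternating_endosD[OF wedge_alternating]
  have uA: "u \<in> A"
    unfolding alternating_endos_def Vector_Spaces.linear_iff u_def
    by (auto simp: vector_space_axioms wl s_sum sum.distrib[symmetric] scale_sum_right algebra_simps intro!: sum.cong)
  have carr: "U \<in> carrier_mat n n" "B \<in> carrier_mat n n"
    using U B by (auto simp: strictly_upper_triangular_mats_def alternating_mats_def)
  have Bsym: "B $$ (j, i) = - B $$ (i, j)" if "i < n" "j < n" for i j
  proof -
    have "B\<^sup>T $$ (i, j) = (- B) $$ (i, j)" using B by (simp add: alternating_mats_def)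
    then show ?thesis using that carr by simp
  qed
  have Bdiag: "B $$ (i, i) = 0" if "i < n" for i using B that by (simp add: alternating_mats_def)
  have ue: "u (e j) = (\<Sum>p<n. U $$ (p, j) *s e p)" if j: "j < n" for j
  proof -
    have "u (e j) = (\<Sum>p<n. \<Sum>q<n. if q = j then U $$ (p, q) *s e p else 0)"
      unfolding u_def using j by (intro sum.cong refl) (auto simp: wedge_def)
    then show ?thesis using j by (simp add: sum.delta)
  qed
  have uf: "u (f j) = (\<Sum>q<n. U $$ (j, q) *s f q) + (\<Sum>i<n. B $$ (i, j) *s e i)" if j: "j < n" for j
  proof -
    have "u (f j) = (\<Sum>p<n. \<Sum>q<n. (if p = j then U $$ (p, q) *s f q else 0) +
        ((if p = j then (if p < q then - B $$ (p, q) else 0) *s e q else 0) +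
         (if q = j then (if p < q then B $$ (p, q) else 0) *s e p else 0)))"
      unfolding u_def using j by (intro sum.cong refl) (auto simp: wedge_def)
    also have "\<dots> = (\<Sum>q<n. U $$ (j, q) *s f q) +
        ((\<Sum>q<n. (if j < q then - B $$ (j, q) else 0) *s e q) + (\<Sum>p<n. (if p < j then B $$ (p, j) else 0) *s e p))"
    proof -
      have 1: "(\<Sum>p<n. \<Sum>q<n. if p = j then g p q else 0) = (\<Sum>q<n. g j q)" for g :: "nat \<Rightarrow> nat \<Rightarrow> 'v"
        by (subst sum.swap) (use j in \<open>simp add: sum.delta\<close>)
      have 2: "(\<Sum>p<n. \<Sum>q<n. if q = j then g p q else 0) = (\<Sum>p<n. g p j)" for g :: "nat \<Rightarrow> nat \<Rightarrow> 'v"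
        using j by (simp add: sum.delta)
      show ?thesis by (simp only: sum.distrib 1 2)
    qed
    also have "(\<Sum>q<n. (if j < q then - B $$ (j, q) else 0) *s e q) + (\<Sum>p<n. (if p < j then B $$ (p, j) else 0) *s e p)
        = (\<Sum>i<n. B $$ (i, j) *s e i)"
      unfolding sum.distrib[symmetric]
    proof (rule sum.cong)
      fix i assume "i \<in> {..<n}"
      then show "(if j < i then - B $$ (j, i) else 0) *s e i + (if i < j then B $$ (i, j) else 0) *s e i = B $$ (i, j) *s e i"
        using Bsym[of j i] Bdiag j by (cases i j rule: linorder_cases) auto
    qed simp
    finally show ?thesis .
  qed
  have "u (e i) \<in> span (e ` {..<i})" if i: "i < n" for i
    unfolding ue[OF i]
  proof (rule span_sum)
    fix p assume "p \<in> {..<n}"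
    then show "U $$ (p, i) *s e p \<in> span (e ` {..<i})"
      using U i span_zero by (cases "p < i") (auto simp: strictly_upper_triangular_mats_def intro!: span_scale intro: span_base)
  qed
  moreover have "matrix_of_endo scale (2 * n) b u = four_block_mat U B (0\<^sub>m n n) (U\<^sup>T)"
  proof (rule eq_matI)
    fix i j assume "i < dim_row (four_block_mat U B (0\<^sub>m n n) (U\<^sup>T))" "j < dim_col (four_block_mat U B (0\<^sub>m n n) (U\<^sup>T))"
    then have ij: "i < 2 * n" "j < 2 * n" using carr by auto
    have "s (u (b j)) (d i) = four_block_mat U B (0\<^sub>m n n) (U\<^sup>T) $$ (i, j)"
    proof (cases "j < n")
      case True
      then show ?thesis using ij carr
        by (auto simp: b_def d_def ue s_sum if_distrib sum.delta cong: if_cong)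
    next
      case False
      then have "j - n < n" using ij by simp
      then show ?thesis using ij carr False
        by (auto simp: b_def d_def uf s_sum if_distrib sum.delta cong: if_cong)
    qed
    then show "matrix_of_endo scale (2 * n) b u $$ (i, j) = four_block_mat U B (0\<^sub>m n n) (U\<^sup>T) $$ (i, j)"
      using ij by (simp add: matrix_of_endo_b)
  qed (use carr in \<open>auto simp: matrix_of_endo_b\<close>)
  ultimately show ?thesis using uA by blast
qed

lemma matrices_of_model:
  "matrix_of_endo scale (2 * n) b ` {u \<in> A. \<forall>i<n. u (e i) \<in> span (e ` {..<i})} = NT_triangle_zero n"
proof
  show "matrix_of_endo scale (2 * n) b ` {u \<in> A. \<forall>i<n. u (e i) \<in> span (e ` {..<i})} \<subseteq> NT_triangle_zero n"
    using matrix_in_NT by blast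
  show "NT_triangle_zero n \<subseteq> matrix_of_endo scale (2 * n) b ` {u \<in> A. \<forall>i<n. u (e i) \<in> span (e ` {..<i})}"
    using NT_matrix_realized unfolding NT_triangle_zero_def by (force simp: image_iff)
qed

end

end

theorem theorem8p2:
  fixes scale :: "'f::field \<Rightarrow> 'v::ab_group_add \<Rightarrow> 'v"
    and s :: "'v \<Rightarrow> 'v \<Rightarrow> 'f"
    and n :: nat
    and S :: "('v \<Rightarrow> 'v) set"
  assumes "infinite (UNIV :: 'f set) \<or> card (UNIV :: 'f set) > 2 * n - 2"
    and "2 * n - 2 \<ge> 2"
    and "symplectic_space scale s"
    and "vector_space.dim scale (UNIV :: 'v set) = 2 * n"
    and "2 * n > 0"
    and "nilpotent_subspace scale (alternating_endos scale s) S"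
  shows "vector_space.dim (fun_scale scale) S \<le> n * (n - 1) \<and>
    (vector_space.dim (fun_scale scale) S = n * (n - 1) \<longrightarrow>
      (\<exists>e. symplectic_basis scale s n e \<and>
           matrix_of_endo scale (2 * n) e ` S = NT_triangle_zero n))"
proof -
  interpret symplectic_space scale s by (rule assms(3))
  obtain Basis where "finite_dimensional_vector_space scale Basis" using finite_dim by blast
  then interpret fd_symplectic scale s Basis
    by (intro fd_symplectic.intro assms(3))
  have S: "S \<subseteq> A" "E.subspace S" "\<And>u. u \<in> S \<Longrightarrow> nilpotent_endo u"
    using assms(6) by (auto simp: nilpotent_subspace_def)
  have "nondeg UNIV" using nondegenerate by (auto simp: nondeg_def)
  then have nil: "nilpotent_alternating scale s Basis UNIV S n"
    using S assms(4) by unfold_locales auto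
  obtain k where k: "has_dim (fun_scale scale) S k" "k \<le> n * (n - 1)"
    using nilpotent_alternating_bound[OF nil] by blast
  have dim: "E.dim S = k" using E.has_dim_imp_dim[OF k(1)] .
  have "\<exists>e. symplectic_basis scale s n e \<and> matrix_of_endo scale (2 * n) e ` S = NT_triangle_zero n"
    if "k = n * (n - 1)"
  proof -
    \<comment> \<open>As \<open>n \<ge> 2\<close>, the number \<open>2 * n - 2\<close> is at least 2
      and at least \<open>n\<close>.\<close>
    have "infinite (UNIV :: 'f set) \<or> 2 < card (UNIV :: 'f set)"
      "infinite (UNIV :: 'f set) \<or> n \<le> card (UNIV :: 'f set)"
      using assms(1,2) by linarith+
    then have model: "triangular_model UNIV S"
      using extremal_triangular_model[OF nil] k(1) that by blast
    obtain e f where ef: "symplectic_family n e f"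
      "S = {u \<in> A. \<forall>i<n. u (e i) \<in> span (e ` {..<i})}"
      using model_symplectic_family[OF model assms(4)] by auto
    show ?thesis
      using symplectic_basis_b[OF ef(1) assms(4)] matrices_of_model[OF ef(1) assms(4)] ef(2) by blast
  qed
  then show ?thesis using k(2) dim by blast
qed

end
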